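(* Let $m\ge 1$, $R=[-\pi,\pi]^m$, and let $\mathcal K\subset\mathbb R^m$ be a compact set contained in the interior of $R$. Let $P$ be a positive integer and suppose $\mathcal K=\bigcup_{j=1}^P K_j$, where $K_j=\overline{\Omega_j}$ and $\Omega_1,\dots,\Omega_P$ are mutually disjoint open sets contained in the interior of $\mathcal K$, each with a Lipschitz boundary or, more generally, with a piecewise smooth boundary that may fail to be Lipschitz, provided that the set of non-smooth boundary points (e.g. corners, edges, or lower-dimensional cusps) has Hausdorff $(m-1)$-measure zero. Let $f:\mathcal K\to\mathbb C$ be a (possibly discontinuous) function whose restriction $f_j=f|_{K_j}$ satisfies $f_j\in C^\infty(K_j)$ for $1\le j\le P$, and let $\widetilde f_j\in C^\infty_{\mathrm{per}}(R)$ be a smooth $R$-periodic extension of $f_j$, that is, $\widetilde f_j|_{K_j}=f_j$. Let $0<a<1$. For $F=(F_1,\dots,F_m)\in\mathbb N^m$ and $n=(n_1,\dots,n_m)\in\mathbb N^m$ define the total error $$E^{n}_{\mathrm{tot}}(F,\widetilde f)=\left|\int_{\mathcal K} f(\mathbf x)\,d\mathbf x-T^{m,R}_n\Big[\sum_{j=1}^P \chi^{K_j}_F\,\widetilde f_j\Big]\right|,$$ where $\chi_F^{K_j}$ is the order-$F$ truncated Fourier series of the characteristic function of $K_j$ and $T_n^{m,R}$ is the $m$-dimensional trapezoidal rule on $R$. Put $F_{\min}=\min_r F_r$, $F_{\max}=\max_r F_r$, $n_{\min}=\min_r n_r$, $n_{\max}=\max_r n_r$. Then: (1) For every positive integer $p$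 there is a constant $C$, independent of $F$ and $n$, such that $$E^{n}_{\mathrm{tot}}(F,\widetilde f)\le C\,\frac{\log(F_{\max})}{(F_{\min})^{p}}$$ for all $F,n\in\mathbb N^m$ with $F_r\le a\,n_r$ for $1\le r\le m$. (2) If, additionally, the relations $2\le n_r/F_r\le M$ hold for $1\le r\le m$ and for some constant $M>0$, then for every positive integer $p$ there is a constant $C$, independent of $F$ and $n$, such that $$E^{n}_{\mathrm{tot}}(F,\widetilde f)\le C\,\frac{\log(n_{\max})}{(n_{\min})^{p}}.$$
   Context: $\mathbb N$ denotes the positive integers. For a compact set $K\subset\mathbb R^m$, $f\in C^\infty(K)$ means that $f:K\to\mathbb C$ and there is $g\in C^\infty(\mathbb R^m)$ with $g|_K=f$. $C^\infty_{\mathrm{per}}(R)$, for $R=[-\pi,\pi]^m$, is the set of functions $g\in C^\infty(R)$ whose $R$-periodic extension to $\mathbb R^m$ ($2\pi$-periodic in each variable) belongs to $C^\infty(\mathbb R^m)$. Functions are complex valued. For a compact set $K\subset R$ with characteristic function $\chi^K$ and for $F\in\mathbb N^m$, the truncated Fourier expansion of $\chi^K$ is $$\chi^K_F(\mathbf x)=\sum_{\ell\in\mathbb Z^m,\ |\ell_r|\le F_r\ (1\le r\le m)} c_\ell\, e^{\mathrm i\,\ell\cdot\mathbf x},\qquad c_\ell=\frac1{(2\pi)^m}\int_R \chi^K(\mathbf x)e^{-\mathrm i\,\ell\cdot\mathbf x}\,d\mathbf x .$$ Trapezoidal rule: for $\beta:[a_0,b_0]\to\mathbb C$ and $q\in\mathbb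 N$, with $h_0=(b_0-a_0)/q$, $$T^{1,[a_0,b_0]}_q[\beta]=\frac{h_0}{2}\big(\beta(a_0)+\beta(b_0)\big)+h_0\sum_{k=1}^{q-1}\beta(a_0+kh_0).$$ For $n=(n_1,\dots,n_m)\in\mathbb N^m$, $T^{m,R}_n$ is the $m$-dimensional rule obtained by applying successively, in each variable $x_r\in[-\pi,\pi]$ ($1\le r\le m$), the one-dimensional rule $T^{1,[-\pi,\pi]}_{n_r}$.
   Formalization: Part (1) is proved for F_max ≥ 2 only; for F = (1,…,1) the right-hand side is C·log 1 = 0, and the claim is false there (e.g. m = 1, K = [-1,1], f = cos 2x, F = 1, n large gives error sin 2). *)

theory Defs
  imports "HOL-Analysis.Analysis"
begin

section \<open>Smooth functions\<close>

text \<open>Intended for open sets \<open>U\<close>: all iterated directional derivatives up to order \<open>k\<close> exist,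
  those of order \<open>k\<close> are continuous and those of lower order are (Frechet) differentiable.\<close>

primrec Ck_on :: "nat \<Rightarrow> 'a::real_normed_vector set \<Rightarrow> ('a \<Rightarrow> 'b::real_normed_vector) \<Rightarrow> bool"
  where
    "Ck_on 0 U f \<longleftrightarrow> continuous_on U f"
  | "Ck_on (Suc k) U f \<longleftrightarrow> (\<forall>x\<in>U. f differentiable (at x)) \<and>
       (\<forall>v. Ck_on k U (\<lambda>x. frechet_derivative f (at x) v))"

definition Cinf_on :: "'a::real_normed_vector set \<Rightarrow> ('a \<Rightarrow> 'b::real_normed_vector) \<Rightarrow> bool"
  where "Cinf_on U f \<longleftrightarrow> (\<forall>k. Ck_on k U f)"

text \<open>\<open>C\<^sup>\<infinity>(K)\<close> for compact \<open>K\<close>: only the values of \<open>f\<close> on \<open>K\<close> matter.\<close>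

definition Cinf_compact :: "(real^'m) set \<Rightarrow> (real^'m \<Rightarrow> complex) \<Rightarrow> bool"
  where "Cinf_compact K f \<longleftrightarrow> (\<exists>g. Cinf_on UNIV g \<and> (\<forall>x\<in>K. g x = f x))"

definition torus_box :: "(real^'m) set"
  where "torus_box = cbox (\<chi> r. - pi) (\<chi> r. pi)"

text \<open>The function \<open>G\<close> below is the periodic extension; it is determined by the values of \<open>g\<close> on
  the box, and exists only if these agree on opposite faces.\<close>

definition Cinf_per :: "(real^'m \<Rightarrow> complex) \<Rightarrow> bool"
  where "Cinf_per g \<longleftrightarrow> Cinf_compact torus_box g \<and>
    (\<exists>G. (\<forall>x r. G (x + axis r (2 * pi)) = G x) \<and> (\<forall>x\<in>torus_box. G x = g x) \<and> Cinf_on UNIV G)"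


section \<open>Boundary regularity\<close>

text \<open>Locally, in suitable orthogonal coordinates with vertical axis \<open>e\<close>, the set is the
  part lying above the graph of a Lipschitz function on the hyperplane orthogonal to \<open>e\<close>.\<close>

definition lipschitz_boundary :: "(real^'m) set \<Rightarrow> bool"
  where "lipschitz_boundary W \<longleftrightarrow>
    (\<forall>x\<in>frontier W. \<exists>U e \<phi> L. open U \<and> x \<in> U \<and> norm e = 1 \<and>
       L-lipschitz_on {z. z \<bullet> e = 0} (\<phi> :: real^'m \<Rightarrow> real) \<and>
       W \<inter> U = {y\<in>U. \<phi> (y - (y \<bullet> e) *\<^sub>R e) < y \<bullet> e})"

definition smooth_hypersurface_at :: "(real^'m) set \<Rightarrow> real^'m \<Rightarrow> bool"
  where "smooth_hypersurface_at S x \<longleftrightarrow> x \<in> S \<and>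
    (\<exists>U g. open U \<and> x \<in> U \<and> Cinf_on U (g :: real^'m \<Rightarrow> real) \<and>
       (\<forall>y\<in>U. frechet_derivative g (at y) \<noteq> (\<lambda>v. 0)) \<and> S \<inter> U = {y\<in>U. g y = 0})"

text \<open>The \<open>d\<close>-dimensional Hausdorff measure without the usual dimensional constant, which has no
  influence on null sets. The empty set is treated separately because \<open>0 ^ 0 = 1\<close>, and
  boundedness is required because \<open>diameter\<close> is meaningless on unbounded sets.\<close>

definition hausdorff_pre :: "nat \<Rightarrow> real \<Rightarrow> 'a::metric_space set \<Rightarrow> ennreal"
  where "hausdorff_pre d \<delta> A =
    (INF U\<in>{U :: nat \<Rightarrow> 'a set. A \<subseteq> (\<Union>i. U i) \<and> (\<forall>i. bounded (U i) \<and> diameter (U i) \<le> \<delta>)}.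
       \<Sum>i. if U i = {} then 0 else ennreal (diameter (U i) ^ d))"

definition hausdorff_meas :: "nat \<Rightarrow> 'a::metric_space set \<Rightarrow> ennreal"
  where "hausdorff_meas d A = (SUP \<delta>\<in>{0<..}. hausdorff_pre d \<delta> A)"

text \<open>The boundary consists of finitely many connected smooth hypersurfaces together with their
  edges, corners, cusps etc.; the points near which the boundary is not a smooth hypersurface
  form a null set for the Hausdorff measure of codimension one.\<close>

definition piecewise_smooth_boundary :: "(real^'m) set \<Rightarrow> bool"
  where "piecewise_smooth_boundary W \<longleftrightarrow>
    (\<exists>\<S>. finite \<S> \<and> (\<forall>S\<in>\<S>. connected S \<and> (\<forall>x\<in>S. smooth_hypersurface_at S x)) \<and>
       frontier W = (\<Union>S\<in>\<S>. closure S)) \<and>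
    hausdorff_meas (CARD('m) - 1) {x \<in> frontier W. \<not> smooth_hypersurface_at (frontier W) x} = 0"


section \<open>Truncated Fourier series of a characteristic function\<close>

definition freq_dot :: "int^'m \<Rightarrow> real^'m \<Rightarrow> real"
  where "freq_dot l x = (\<Sum>r\<in>UNIV. of_int (l $ r) * x $ r)"

definition char_coeff :: "(real^'m) set \<Rightarrow> int^'m \<Rightarrow> complex"
  where "char_coeff K l = 1 / (2 * of_real pi) ^ CARD('m) *
    integral torus_box (\<lambda>x. indicator K x * exp (- \<i> * of_real (freq_dot l x)))"

definition char_trunc :: "(real^'m) set \<Rightarrow> nat^'m \<Rightarrow> real^'m \<Rightarrow> complex"
  where "char_trunc K F x =
    (\<Sum>l\<in>{l :: int^'m. \<forall>r. \<bar>l $ r\<bar> \<le> int (F $ r)}. char_coeff K l * exp (\<i> * of_real (freq_dot l x)))"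

lemma finite_freq_box: "finite {l :: int^'m. \<forall>r. \<bar>l $ r\<bar> \<le> int (F $ r)}"
proof -
  have "{l :: int^'m. \<forall>r. \<bar>l $ r\<bar> \<le> int (F $ r)} \<subseteq>
      vec_lambda ` (\<Pi>\<^sub>E r\<in>UNIV. {- int (F $ r)..int (F $ r)})"
  proof
    fix l :: "int^'m"
    assume "l \<in> {l. \<forall>r. \<bar>l $ r\<bar> \<le> int (F $ r)}"
    then have "($) l \<in> (\<Pi>\<^sub>E r\<in>UNIV. {- int (F $ r)..int (F $ r)})"
      by (auto simp: abs_le_iff minus_le_iff)
    then show "l \<in> vec_lambda ` (\<Pi>\<^sub>E r\<in>UNIV. {- int (F $ r)..int (F $ r)})"
      by (metis image_eqI vec_lambda_eta)
  qed
  then show ?thesis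
    by (rule finite_subset) (intro finite_imageI finite_PiE, simp_all)
qed


section \<open>Trapezoidal rule\<close>

definition trapezoid :: "real \<Rightarrow> real \<Rightarrow> nat \<Rightarrow> (real \<Rightarrow> complex) \<Rightarrow> complex"
  where "trapezoid a b q \<beta> = (let h = (b - a) / real q in
    of_real (h / 2) * (\<beta> a + \<beta> b) + of_real h * (\<Sum>k = 1..q - 1. \<beta> (a + real k * h)))"

definition trapezoid_var :: "nat^'m \<Rightarrow> 'm \<Rightarrow> (real^'m \<Rightarrow> complex) \<Rightarrow> real^'m \<Rightarrow> complex"
  where "trapezoid_var n r g = (\<lambda>x. trapezoid (- pi) pi (n $ r) (\<lambda>t. g (\<chi> s. if s = r then t else x $ s)))"

text \<open>The one-dimensional rule is applied once in every variable. The order is immaterial by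
  \<open>comp_fun_commute_trapezoid_var\<close>, so that \<open>Finite_Set.fold\<close> is well-defined. The result no
  longer depends on the point of evaluation, for which \<open>0\<close> is taken.\<close>

definition trapezoid_box :: "nat^'m \<Rightarrow> (real^'m \<Rightarrow> complex) \<Rightarrow> complex"
  where "trapezoid_box n g = Finite_Set.fold (trapezoid_var n) g UNIV 0"

lemma trapezoid_swap:
  "trapezoid a b p (\<lambda>s. trapezoid c d q (\<lambda>t. g s t)) = trapezoid c d q (\<lambda>t. trapezoid a b p (\<lambda>s. g s t))"
proof -
  have lin: "trapezoid c d q (\<lambda>t. \<alpha> * f1 t) = \<alpha> * trapezoid c d q f1"
    "trapezoid c d q (\<lambda>t. f1 t + f2 t) = trapezoid c d q f1 + trapezoid c d q f2"
    for \<alpha> f1 f2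
    by (simp_all add: trapezoid_def Let_def sum.distrib sum_distrib_left distrib_left mult.left_commute)
  have zero: "trapezoid c d q (\<lambda>t. 0) = 0"
    by (simp add: trapezoid_def Let_def)
  have sum: "trapezoid c d q (\<lambda>t. \<Sum>k\<in>A. f3 k t) = (\<Sum>k\<in>A. trapezoid c d q (f3 k))"
    if "finite A" for A :: "nat set" and f3
    using that by (induction A) (simp_all add: lin zero)
  define h where "h = (b - a) / real p"
  have eq: "trapezoid a b p \<beta> =
      of_real (h / 2) * (\<beta> a + \<beta> b) + of_real h * (\<Sum>k = 1..p - 1. \<beta> (a + real k * h))" for \<beta>
    by (simp only: trapezoid_def Let_def h_def)
  show ?thesis
    by (simp only: eq lin sum finite_atLeastAtMost)
qed

lemma comp_fun_commute_trapezoid_var: "comp_fun_commute (trapezoid_var n)"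
proof
  fix r s
  show "trapezoid_var n s \<circ> trapezoid_var n r = trapezoid_var n r \<circ> trapezoid_var n s"
  proof (cases "r = s")
    case False
    have upd: "(\<chi> i. if i = r then t else (\<chi> i. if i = s then u else x $ i) $ i) =
        (\<chi> i. if i = s then u else (\<chi> i. if i = r then t else x $ i) $ i)" for t u :: real and x
      using False by (auto simp: vec_eq_iff)
    show ?thesis
      unfolding comp_def trapezoid_var_def upd by (intro ext trapezoid_swap)
  qed simp
qed


section \<open>Total error\<close>

text \<open>\<open>D\<close> is the domain of integration, \<open>K j\<close> for \<open>1 \<le> j \<le> P\<close> are its pieces and \<open>ft j\<close> the
  periodic extensions.\<close>

definition total_error ::
  "(real^'m) set \<Rightarrow> nat \<Rightarrow> (nat \<Rightarrow> (real^'m) set) \<Rightarrow> (real^'m \<Rightarrow> complex) \<Rightarrow>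
   (nat \<Rightarrow> real^'m \<Rightarrow> complex) \<Rightarrow> nat^'m \<Rightarrow> nat^'m \<Rightarrow> real"
  where "total_error D P K f ft n F =
    cmod (integral D f - trapezoid_box n (\<lambda>x. \<Sum>j = 1..P. char_trunc (K j) F x * ft j x))"

definition vmin :: "nat^'m \<Rightarrow> nat"
  where "vmin F = Min (range (\<lambda>r. F $ r))"

definition vmax :: "nat^'m \<Rightarrow> nat"
  where "vmax F = Max (range (\<lambda>r. F $ r))"

end

(*
Since f = ft j on K j and the boundaries of the pieces are null sets, it suffices to treat each
piece separately. Expand ft j = sum_k b_k exp(i k.x); by smoothness b_k decays faster than any power
of the frequency. The trapezoidal rule maps exp(i k.x) to 0 unless n_r divides k_r for all r, so with
c_l the Fourier coefficients of the characteristic function the error of the piece is, up to the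
factor (2 pi)^m,
  sum_k b_k (c_{-k} - sum over |l_r| <= F_r with n_r | l_r + k_r of (+-1) c_l).
The parenthesis is bounded by 1 + 2^m, and it vanishes if |k_r| <= F_r and |k_r| < n_r - F_r for
all r, because then l = -k is the only term. As n_r - F_r >= (1/a - 1) F_r, only frequencies
exceeding a fixed multiple of F_min contribute. This gives O(F_min^(-p)) even without the logarithm.
*)
theory Submission
  imports Defs
begin

section \<open>Boundaries of the pieces are null sets\<close>

text \<open>The Fourier coefficients c_l of an indicator function in general decay slowly, so the
  indicator is never expanded in an infinite series: all convergence is borrowed from the smooth
  factor, and c_l enters only through |c_l| <= 1. Truncation and aliasing are therefore estimated
  together, one mode of the smooth factor at a time, and the geometry of the boundaries enters by
  making the pieces overlap in null sets. The main obstacle is a pointwise, absolutely convergent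
  Fourier expansion in m variables. Decay of the coefficients comes from differentiating a
  translation-invariant integral, which avoids the boundary terms of an integration by parts.
  Completeness comes from moving periodic functions to the compact image of the box in C^m, where
  the Stone-Weierstrass theorem applies. The decay estimate has two separate factors: one is
  summable over the lattice, the other is kept in reserve and supplies the power of F_min.\<close>

lemma negligible_lipschitz_graph:
  fixes \<phi> :: "'a::euclidean_space \<Rightarrow> real" and e :: 'a
  assumes "norm e = 1" and lip: "L-lipschitz_on {z. z \<bullet> e = 0} \<phi>"
  shows "negligible {y. \<phi> (y - (y \<bullet> e) *\<^sub>R e) = y \<bullet> e}"
proof -
  let ?H = "{z. z \<bullet> e = 0}"
  have [simp]: "e \<bullet> e = 1" using assms(1) by (simp add: dot_square_norm)
  have "e \<noteq> 0" using assms(1) by auto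
  then have "negligible {z. e \<bullet> z = 0}" by (intro negligible_hyperplane) simp
  then have H: "negligible ?H" by (simp add: inner_commute)
  \<comment> \<open>The graph is parametrized by the hyperplane, which is already null in the full
    space, through a Lipschitz map of the space into itself. Such maps preserve null sets.\<close>
  have "negligible ((\<lambda>z. z + \<phi> z *\<^sub>R e) ` ?H)"
  proof (rule negligible_locally_Lipschitz_image[OF order_refl H])
    fix x assume x: "x \<in> ?H"
    have "norm ((y + \<phi> y *\<^sub>R e) - (x + \<phi> x *\<^sub>R e)) \<le> (1 + L) * norm (y - x)" if y: "y \<in> ?H" for y
    proof -
      have "norm ((y + \<phi> y *\<^sub>R e) - (x + \<phi> x *\<^sub>R e)) = norm ((y - x) + (\<phi> y - \<phi> x) *\<^sub>R e)"
        by (simp add: algebra_simps)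
      also have "\<dots> \<le> norm (y - x) + \<bar>\<phi> y - \<phi> x\<bar> * norm e"
        by (metis norm_triangle_ineq norm_scaleR)
      also have "\<dots> \<le> norm (y - x) + L * norm (y - x)"
        using lipschitz_onD[OF lip y x] by (simp add: dist_norm assms(1))
      finally show ?thesis by (simp add: algebra_simps)
    qed
    then show "\<exists>T B. open T \<and> x \<in> T \<and> (\<forall>y\<in>?H \<inter> T.
        norm ((y + \<phi> y *\<^sub>R e) - (x + \<phi> x *\<^sub>R e)) \<le> B * norm (y - x))"
      by (intro exI[of _ UNIV] exI[of _ "1 + L"]) auto
  qed
  then show ?thesis
  proof (rule negligible_subset)
    show "{y. \<phi> (y - (y \<bullet> e) *\<^sub>R e) = y \<bullet> e} \<subseteq> (\<lambda>z. z + \<phi> z *\<^sub>R e) ` ?H"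
    proof
      fix y assume "y \<in> {y. \<phi> (y - (y \<bullet> e) *\<^sub>R e) = y \<bullet> e}"
      then show "y \<in> (\<lambda>z. z + \<phi> z *\<^sub>R e) ` ?H"
        by (intro image_eqI[of _ _ "y - (y \<bullet> e) *\<^sub>R e"]) (auto simp: inner_diff_left)
    qed
  qed
qed

lemma locally_negligible_open:
  assumes "\<And>x. x \<in> S \<Longrightarrow> \<exists>U. open U \<and> x \<in> U \<and> negligible (S \<inter> U)"
  shows "negligible S"
  using assms by (intro locally_negligible_alt[THEN iffD2]) (metis IntI openin_open_Int)

text \<open>Inside \<open>U\<close>, points above the graph belong to the open set \<open>W\<close>
  and so are not on its frontier, while points below have a neighbourhood that avoids
  \<open>W\<close>. Only the graph itself remains.\<close>

lemma negligible_frontier_lipschitz: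
  assumes "open W" "lipschitz_boundary W"
  shows "negligible (frontier W)"
proof (rule locally_negligible_open)
  fix x assume "x \<in> frontier W"
  then obtain U e \<phi> L where U: "open U" "x \<in> U" and e: "norm e = 1"
    and lip: "L-lipschitz_on {z. z \<bullet> e = 0} (\<phi> :: real^_ \<Rightarrow> real)"
    and WU: "W \<inter> U = {y\<in>U. \<phi> (y - (y \<bullet> e) *\<^sub>R e) < y \<bullet> e}"
    using assms(2)[unfolded lipschitz_boundary_def, rule_format, OF \<open>x \<in> frontier W\<close>]
    by (elim exE conjE) (rule that)
  let ?h = "\<lambda>y. \<phi> (y - (y \<bullet> e) *\<^sub>R e) - y \<bullet> e"
  have "e \<bullet> e = 1" using e by (simp add: dot_square_norm)
  then have h: "continuous_on UNIV ?h"
    by (intro continuous_intros continuous_on_compose2[OF lipschitz_on_continuous_on[OF lip]])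
       (auto simp: inner_diff_left)
  have op: "open {y. 0 < ?h y}"
    by (rule open_Collect_less[OF continuous_on_const h])
  have "frontier W \<inter> U \<subseteq> {y. \<phi> (y - (y \<bullet> e) *\<^sub>R e) = y \<bullet> e}"
  proof
    fix y assume y: "y \<in> frontier W \<inter> U"
    have "y \<notin> W" using y assms(1) by (auto simp: frontier_def interior_open)
    then have "\<not> ?h y < 0" using WU y by auto
    moreover have "\<not> 0 < ?h y"
    proof
      assume "0 < ?h y"
      have "open (U \<inter> {y. 0 < ?h y})" using op U by blast
      moreover have "(U \<inter> {y. 0 < ?h y}) \<inter> W = {}" using WU by force
      ultimately have "(U \<inter> {y. 0 < ?h y}) \<inter> closure W = {}"
        by (simp only: open_Int_closure_eq_empty)
      moreover have "y \<in> closure W" using y by (auto simp: frontier_def)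
      ultimately show False using y \<open>0 < ?h y\<close> by blast
    qed
    ultimately show "y \<in> {y. \<phi> (y - (y \<bullet> e) *\<^sub>R e) = y \<bullet> e}" by simp
  qed
  then show "\<exists>U. open U \<and> x \<in> U \<and> negligible (frontier W \<inter> U)"
    using U negligible_subset[OF negligible_lipschitz_graph[OF e lip]] by (intro exI[of _ U]) simp
qed

text \<open>Stands in for the implicit function theorem and needs only pointwise differentiability.
  Where the \<open>r\<close>-th partial derivative is nonzero, replacing the \<open>r\<close>-th
  coordinate by \<open>g\<close> gives a map with injective derivative, and the level set is the
  preimage of a coordinate hyperplane under it. Finitely many \<open>r\<close> exhaust
  \<open>U\<close>.\<close>

lemma negligible_level_set:
  fixes g :: "real^'m \<Rightarrow> real"
  assumes "\<And>x. x \<in> U \<Longrightarrow> g differentiable (at x)"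
    and "\<And>x. x \<in> U \<Longrightarrow> frechet_derivative g (at x) \<noteq> (\<lambda>v. 0)"
  shows "negligible {x\<in>U. g x = 0}"
proof -
  let ?D = "\<lambda>x. frechet_derivative g (at x)"
  define S where "S r = {x\<in>U. ?D x (axis r 1) \<noteq> 0}" for r
  have "negligible {x\<in>S r. (\<chi> s. if s = r then g x else x $ s) \<in> {y. y $ r = 0}}" for r
  proof (rule negligible_differentiable_vimage)
    have "negligible {y::real^'m. axis r 1 \<bullet> y = 0}"
      by (intro negligible_hyperplane) (simp add: axis_eq_0_iff)
    then show "negligible {y::real^'m. y $ r = 0}" by (simp add: inner_axis')
  next
    fix x assume x: "x \<in> S r"
    have D: "(g has_derivative ?D x) (at x)"
      using assms(1) x S_def frechet_derivative_works by blast
    interpret D: bounded_linear "?D x" using D by (rule has_derivative_bounded_linear)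
    let ?T = "\<lambda>v. (\<chi> s. if s = r then ?D x v else v $ s)"
    \<comment> \<open>Rewriting the coordinate replacement as a rank-one correction of the identity
      lets the derivative rules for sums and products apply.\<close>
    have T: "?T v = v + (?D x v - v $ r) *\<^sub>R axis r 1" for v
      by (auto simp: vec_eq_iff axis_def)
    have F: "(\<chi> s. if s = r then g y else y $ s) = y + (g y - y $ r) *\<^sub>R axis r 1" for y
      by (auto simp: vec_eq_iff axis_def)
    show "((\<lambda>y. (\<chi> s. if s = r then g y else y $ s)) has_derivative ?T) (at x within S r)"
      unfolding T F
      by (rule has_derivative_at_withinI)
        (auto intro!: derivative_eq_intros D bounded_linear_imp_has_derivative bounded_linear_vec_nth)
    show "inj ?T"
    proof (rule injI)
      fix v w assume eq: "?T v = ?T w"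
      have comp: "(if s = r then ?D x v else v $ s) = (if s = r then ?D x w else w $ s)" for s
        using arg_cong[OF eq, of "\<lambda>u. u $ s"] by (simp only: vec_lambda_beta)
      then have ne: "v $ s = w $ s" if "s \<noteq> r" for s
        using that by metis
      have "?D x v = ?D x w" using comp[of r] by simp
      then have "?D x (v - w) = 0" by (simp add: D.diff)
      moreover have "v - w = (v $ r - w $ r) *\<^sub>R axis r 1"
        using ne by (auto simp: vec_eq_iff axis_def)
      ultimately have "(v $ r - w $ r) * ?D x (axis r 1) = 0"
        by (metis D.scaleR real_scaleR_def)
      then have "v $ r = w $ r" using x by (auto simp: S_def)
      then show "v = w" using ne by (metis vec_eq_iff)
    qed
  qed
  then have "negligible (\<Union>r\<in>UNIV. {x\<in>S r. (\<chi> s. if s = r then g x else x $ s) \<in> {y. y $ r = 0}})"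
    by (intro negligible_Union) auto
  then show ?thesis
  proof (rule negligible_subset, intro subsetI)
    fix x assume x: "x \<in> {x\<in>U. g x = 0}"
    then have D: "(g has_derivative ?D x) (at x)"
      using assms(1) frechet_derivative_works by blast
    interpret D: bounded_linear "?D x" using D by (rule has_derivative_bounded_linear)
    have "\<exists>r. ?D x (axis r 1) \<noteq> 0"
    proof (rule ccontr)
      assume "\<not> ?thesis"
      then have "?D x v = 0" for v
        using D.sum[of "\<lambda>r. v $ r *\<^sub>R axis r 1" UNIV] basis_expansion[of v]
        by (simp add: D.scaleR scalar_mult_eq_scaleR)
      then show False using assms(2) x by auto
    qed
    then show "x \<in> (\<Union>r\<in>UNIV. {x\<in>S r. (\<chi> s. if s = r then g x else x $ s) \<in> {y. y $ r = 0}})"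
      using x by (auto simp: S_def)
  qed
qed

section \<open>Hausdorff null sets are Lebesgue null sets\<close>

lemma borel_cover_of_bounded:
  fixes A :: "'a::euclidean_space set"
  assumes "bounded A"
  obtains T where "A \<subseteq> T" "T \<in> sets lborel"
    "emeasure lborel T \<le> ennreal (unit_ball_vol (DIM('a)) * diameter A ^ DIM('a))"
proof (cases "A = {}")
  case False
  then obtain c where c: "c \<in> A" by auto
  have "A \<subseteq> cball c (diameter A)"
    using diameter_bounded_bound[OF assms c] by auto
  moreover have "emeasure lborel (cball c (diameter A)) =
      ennreal (unit_ball_vol (DIM('a)) * diameter A ^ DIM('a))"
    using diameter_ge_0[OF assms] by (intro emeasure_cball)
  ultimately show ?thesis by (intro that[of "cball c (diameter A)"]) auto
qed (use that[of "{}"] in simp)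

text \<open>Covers at the single scale 1 suffice: a set of diameter at most 1 lies in a ball around
  one of its points whose volume is at most \<open>\<omega>\<close> times the \<open>d\<close>-th
  power of the diameter, because \<open>d\<close> does not exceed the dimension. The covering sets
  may be non-measurable, so they are first enlarged to Borel sets.\<close>

lemma negligible_hausdorff_null:
  fixes A :: "'a::euclidean_space set"
  assumes "hausdorff_meas d A = 0" "d \<le> DIM('a)"
  shows "negligible A"
proof -
  define \<omega> where "\<omega> = unit_ball_vol (real DIM('a))"
  have "\<omega> > 0" by (simp add: \<omega>_def unit_ball_vol_pos)
  have pre: "hausdorff_pre d 1 A = 0"
    using assms(1) unfolding hausdorff_meas_def
    by (metis SUP_upper le_zero_eq greaterThan_iff zero_less_one)
  show ?thesis
    unfolding negligible_outer_le
  proof (intro allI impI)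
    fix \<epsilon> :: real assume "\<epsilon> > 0"
    then have "0 < ennreal (\<epsilon> / \<omega>)" using \<open>\<omega> > 0\<close> by (simp add: ennreal_less_zero_iff)
    then have "hausdorff_pre d 1 A < ennreal (\<epsilon> / \<omega>)" using pre by simp
    then obtain U where U: "A \<subseteq> (\<Union>i. U i)" "\<And>i. bounded (U i)" "\<And>i. diameter (U i) \<le> 1"
      and less: "(\<Sum>i::nat. if U i = {} then 0 else ennreal (diameter (U i) ^ d)) < ennreal (\<epsilon> / \<omega>)"
      unfolding hausdorff_pre_def INF_less_iff by auto
    have "\<exists>T. U i \<subseteq> T \<and> T \<in> sets lborel \<and>
        emeasure lborel T \<le> ennreal \<omega> * (if U i = {} then 0 else ennreal (diameter (U i) ^ d))" for i
    proof (cases "U i = {}")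
      case False
      obtain T where T: "U i \<subseteq> T" "T \<in> sets lborel"
        "emeasure lborel T \<le> ennreal (\<omega> * diameter (U i) ^ DIM('a))"
        using borel_cover_of_bounded[OF U(2)] unfolding \<omega>_def by blast
      have "\<omega> * diameter (U i) ^ DIM('a) \<le> \<omega> * diameter (U i) ^ d"
        using U(3) diameter_ge_0[OF U(2)] assms(2) \<open>\<omega> > 0\<close>
        by (intro mult_left_mono power_decreasing) auto
      then have "ennreal (\<omega> * diameter (U i) ^ DIM('a)) \<le> ennreal \<omega> * ennreal (diameter (U i) ^ d)"
        using \<open>\<omega> > 0\<close> diameter_ge_0[OF U(2)] by (simp flip: ennreal_mult)
      then show ?thesis using T False by (intro exI[of _ T]) auto
    qed (auto intro: exI[of _ "{}"])
    then obtain T where T: "\<And>i. U i \<subseteq> T i" "\<And>i. T i \<in> sets lborel"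
      "\<And>i. emeasure lborel (T i) \<le> ennreal \<omega> * (if U i = {} then 0 else ennreal (diameter (U i) ^ d))"
      by metis
    have "emeasure lborel (\<Union>i. T i) \<le> (\<Sum>i. emeasure lborel (T i))"
      using T(2) by (intro emeasure_subadditive_countably) auto
    also have "\<dots> \<le> (\<Sum>i. ennreal \<omega> * (if U i = {} then 0 else ennreal (diameter (U i) ^ d)))"
      using T(3) by (intro suminf_le) auto
    also have "\<dots> = ennreal \<omega> * (\<Sum>i. if U i = {} then 0 else ennreal (diameter (U i) ^ d))"
      by simp
    also have "\<dots> \<le> ennreal \<omega> * ennreal (\<epsilon> / \<omega>)"
      using less by (intro mult_left_mono) auto
    also have "\<dots> = ennreal \<epsilon>"
      using \<open>\<omega> > 0\<close> \<open>\<epsilon> > 0\<close> by (simp flip: ennreal_mult)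
    finally have le: "emeasure lborel (\<Union>i. T i) \<le> ennreal \<epsilon>" .
    have TS: "(\<Union>i. T i) \<in> sets lborel" using T(2) by auto
    then have le': "emeasure lebesgue (\<Union>i. T i) \<le> ennreal \<epsilon>" using le by simp
    then have "(\<Union>i. T i) \<in> lmeasurable"
      using TS le_less_trans[OF le' ennreal_less_top]
      by (intro fmeasurableI) (simp_all add: sets_completionI_sets)
    moreover have "measure lebesgue (\<Union>i. T i) \<le> \<epsilon>"
      unfolding measure_def using le' \<open>\<epsilon> > 0\<close> by (intro enn2real_leI) auto
    ultimately
    show "\<exists>T. A \<subseteq> T \<and> T \<in> lmeasurable \<and> measure lebesgue T \<le> \<epsilon>"
      using U(1) T(1) by (intro exI[of _ "\<Union>i. T i"]) blast
  qed
qed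

text \<open>Near a regular point the frontier is a level set with nonvanishing differential; the
  singular points are null for the Hausdorff measure of codimension one.\<close>

lemma negligible_frontier_piecewise_smooth:
  fixes W :: "(real^'m) set"
  assumes "piecewise_smooth_boundary W"
  shows "negligible (frontier W)"
proof -
  let ?B = "{x \<in> frontier W. \<not> smooth_hypersurface_at (frontier W) x}"
  let ?G = "{x \<in> frontier W. smooth_hypersurface_at (frontier W) x}"
  have "negligible ?B"
    using assms unfolding piecewise_smooth_boundary_def
    by (intro negligible_hausdorff_null[of "CARD('m) - 1"]) auto
  moreover have "negligible ?G"
  proof (rule locally_negligible_open)
    fix x assume "x \<in> ?G"
    then obtain U g where U: "open U" "x \<in> U" and g: "Cinf_on U (g :: real^'m \<Rightarrow> real)"
      "\<forall>y\<in>U. frechet_derivative g (at y) \<noteq> (\<lambda>v. 0)" "frontier W \<inter> U = {y\<in>U. g y = 0}"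
      unfolding smooth_hypersurface_at_def by blast
    from g(1) have "Ck_on (Suc 0) U g" unfolding Cinf_on_def by blast
    then have "negligible {y\<in>U. g y = 0}" using g(2) by (intro negligible_level_set) auto
    then have "negligible (?G \<inter> U)" using g(3) by (elim negligible_subset) auto
    then show "\<exists>U. open U \<and> x \<in> U \<and> negligible (?G \<inter> U)" using U by blast
  qed
  ultimately have "negligible (?B \<union> ?G)" by (rule negligible_Un)
  moreover have "?B \<union> ?G = frontier W" by blast
  ultimately show ?thesis by (rule back_subst)
qed

section \<open>Fourier characters\<close>

definition fchar :: "int^'m \<Rightarrow> real^'m \<Rightarrow> complex"
  where "fchar k x = exp (\<i> * of_real (freq_dot k x))"

lemma freq_dot_add_left: "freq_dot (k + l) x = freq_dot k x + freq_dot l x"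
  by (simp add: freq_dot_def distrib_right sum.distrib)

lemma freq_dot_add_right: "freq_dot k (x + y) = freq_dot k x + freq_dot k y"
  by (simp add: freq_dot_def distrib_left sum.distrib)

lemma freq_dot_minus_left: "freq_dot (- k) x = - freq_dot k x"
  by (simp add: freq_dot_def sum_negf)

lemma freq_dot_axis_right: "freq_dot k (axis r t) = of_int (k $ r) * t"
proof -
  have "freq_dot k (axis r t) = (\<Sum>s\<in>UNIV. if s = r then of_int (k $ r) * t else 0)"
    unfolding freq_dot_def by (intro sum.cong) (auto simp: axis_def)
  then show ?thesis by simp
qed

lemma freq_dot_axis_left: "freq_dot (axis r j) x = of_int j * x $ r"
proof -
  have "freq_dot (axis r j) x = (\<Sum>s\<in>UNIV. if s = r then of_int j * x $ r else 0)"
    unfolding freq_dot_def by (intro sum.cong) (auto simp: axis_def)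
  then show ?thesis by simp
qed

lemma fchar_add_left: "fchar (k + l) x = fchar k x * fchar l x"
  by (simp add: fchar_def freq_dot_add_left exp_add distrib_left)

lemma fchar_add_right: "fchar k (x + y) = fchar k x * fchar k y"
  by (simp add: fchar_def freq_dot_add_right exp_add distrib_left)

lemma fchar_0 [simp]: "fchar 0 x = 1"
  by (simp add: fchar_def freq_dot_def)

lemma fchar_minus_mult [simp]: "fchar (- k) x * fchar k x = 1" "fchar k x * fchar (- k) x = 1"
  by (simp_all flip: fchar_add_left)

lemma norm_fchar [simp]: "cmod (fchar k x) = 1"
  by (simp add: fchar_def)

lemma fchar_axis_right: "fchar k (axis r t) = exp (\<i> * of_real (of_int (k $ r) * t))"
  by (simp add: fchar_def freq_dot_axis_right)

lemma fchar_periodic: "fchar k (x + axis r (2 * pi)) = fchar k x"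
proof -
  have "fchar k (axis r (2 * pi)) = exp (of_int (k $ r) * (2 * of_real pi * \<i>))"
    by (simp add: fchar_axis_right algebra_simps)
  also have "\<dots> = 1"
    by (subst exp_eq_1) (auto intro!: exI[of _ "k $ r"])
  finally show ?thesis by (simp add: fchar_add_right)
qed

lemma continuous_on_fchar [continuous_intros]: "continuous_on S (fchar k)"
  unfolding fchar_def freq_dot_def by (intro continuous_intros)

definition periodic_box :: "(real^'m \<Rightarrow> 'b) \<Rightarrow> bool"
  where "periodic_box G \<longleftrightarrow> (\<forall>x r. G (x + axis r (2 * pi)) = G x)"

lemma integrable_continuous_on_compact:
  fixes f :: "'a::euclidean_space \<Rightarrow> 'b::euclidean_space"
  assumes "compact S" "continuous_on S f"
  shows "f integrable_on S"
  using borel_integrable_compact[OF assms] set_borel_integral_eq_integral(1)[of S f]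
  by (simp add: set_integrable_def)

lemma compact_torus_box [simp]: "compact torus_box"
  by (simp add: torus_box_def)

lemma content_torus_box: "measure lborel (torus_box :: (real^'m) set) = (2 * pi) ^ CARD('m)"
  unfolding torus_box_def by (subst content_cbox_cart) (auto simp: interval_ne_empty_cart)

section \<open>Translation of integrals of periodic functions\<close>

text \<open>Only the \<open>r\<close>-th side is variable, so that translation along this axis stays
  within the family.\<close>

definition slab :: "'m \<Rightarrow> real \<Rightarrow> real \<Rightarrow> (real^'m) set"
  where "slab r u v = cbox (\<chi> s. if s = r then u else - pi) (\<chi> s. if s = r then v else pi)"

lemma mem_slab: "x \<in> slab r u v \<longleftrightarrow> (u \<le> x $ r \<and> x $ r \<le> v) \<and> (\<forall>s. s \<noteq> r \<longrightarrow> - pi \<le> x $ s \<and> x $ s \<le> pi)"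
  unfolding slab_def mem_box_cart by auto

lemma torus_box_slab: "torus_box = slab r (- pi) pi"
  unfolding slab_def torus_box_def by simp

lemma integral_slab_split:
  fixes f :: "real^'m \<Rightarrow> complex"
  assumes "continuous_on UNIV f" "u \<le> v" "v \<le> w"
  shows "integral (slab r u w) f = integral (slab r u v) f + integral (slab r v w) f"
proof -
  have "f integrable_on slab r u w"
    unfolding slab_def using assms(1) continuous_on_subset by (blast intro: integrable_continuous)
  then have "integral (slab r u w) f = integral (slab r u w \<inter> {x. x \<bullet> axis r 1 \<le> v}) f
      + integral (slab r u w \<inter> {x. x \<bullet> axis r 1 \<ge> v}) f"
    unfolding slab_def by (rule integral_split) (simp add: axis_in_Basis_iff)
  moreover have "slab r u w \<inter> {x. x \<bullet> axis r 1 \<le> v} = slab r u v"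
    using assms by (auto simp: mem_slab inner_axis)
  moreover have "slab r u w \<inter> {x. x \<bullet> axis r 1 \<ge> v} = slab r v w"
    using assms by (auto simp: mem_slab inner_axis)
  ultimately show ?thesis by simp
qed

lemma integral_slab_translate:
  fixes f :: "real^'m \<Rightarrow> complex"
  assumes "continuous_on UNIV f"
  shows "integral (slab r u v) (\<lambda>x. f (x + axis r t)) = integral (slab r (u + t) (v + t)) f"
proof -
  have "f integrable_on slab r (u + t) (v + t)"
    unfolding slab_def using assms(1) continuous_on_subset by (blast intro: integrable_continuous)
  then have "(f has_integral integral (slab r (u + t) (v + t)) f) (slab r (u + t) (v + t))"
    by (rule integrable_integral)
  from has_integral_affinity[OF this[unfolded slab_def], of 1 "axis r t"]
  have "((\<lambda>x. f (x + axis r t)) has_integral integral (slab r (u + t) (v + t)) f)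
      ((\<lambda>x. x - axis r t) ` slab r (u + t) (v + t))"
    by (simp add: slab_def)
  moreover have "(\<lambda>x. x - axis r t) ` slab r (u + t) (v + t) = slab r u v"
  proof (intro set_eqI iffI)
    fix x :: "real^'m" assume "x \<in> slab r u v"
    then show "x \<in> (\<lambda>x. x - axis r t) ` slab r (u + t) (v + t)"
      by (intro image_eqI[of _ _ "x + axis r t"]) (auto simp: mem_slab axis_def)
  qed (auto simp: mem_slab axis_def)
  ultimately show ?thesis by (simp add: integral_unique)
qed

text \<open>The part of the translated box that sticks out beyond \<open>pi\<close> is moved back by
  one period and fills the gap left at \<open>- pi\<close>. Shifts up to one period cover the
  half-wavelength shift and the one-sided derivative used below.\<close>

lemma integral_torus_translate:
  fixes f :: "real^'m \<Rightarrow> complex"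
  assumes f: "continuous_on UNIV f" and per: "periodic_box f" and t: "0 \<le> t" "t \<le> 2 * pi"
  shows "integral torus_box (\<lambda>x. f (x + axis r t)) = integral torus_box f"
proof -
  have "integral torus_box (\<lambda>x. f (x + axis r t)) = integral (slab r (- pi + t) (pi + t)) f"
    unfolding torus_box_slab[of r] by (rule integral_slab_translate[OF f])
  also have "\<dots> = integral (slab r (- pi + t) pi) f + integral (slab r pi (pi + t)) f"
    using t by (intro integral_slab_split[OF f]) auto
  also have "integral (slab r pi (pi + t)) f = integral (slab r (- pi) (- pi + t)) (\<lambda>x. f (x + axis r (2 * pi)))"
    by (subst integral_slab_translate[OF f]) (simp add: algebra_simps)
  also have "(\<lambda>x. f (x + axis r (2 * pi))) = f"
    using per by (auto simp: periodic_box_def)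
  also have "integral (slab r (- pi + t) pi) f + integral (slab r (- pi) (- pi + t)) f = integral torus_box f"
    unfolding torus_box_slab[of r] using t
    by (subst integral_slab_split[OF f, of "- pi" "- pi + t" pi]) auto
  finally show ?thesis .
qed

lemma integral_fchar:
  "integral torus_box (fchar (k :: int^'m)) = (if k = 0 then (2 * of_real pi) ^ CARD('m) else 0)"
proof (cases "k = 0")
  case True
  have "integral torus_box (\<lambda>x::real^'m. 1::complex) = of_real (measure lborel (torus_box :: (real^'m) set))"
    unfolding torus_box_def by (simp add: scaleR_conv_of_real)
  then show ?thesis using True by (simp add: content_torus_box fchar_0[abs_def] flip: fun_eq_iff cong: integral_cong)
next
  case False
  then obtain r where r: "k $ r \<noteq> 0" by (auto simp: vec_eq_iff)
  \<comment> \<open>Half a wavelength in direction \<open>r\<close>: this shift changes the sign of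
    \<open>fchar k\<close> but preserves its integral, which must therefore vanish.\<close>
  define t where "t = pi / \<bar>real_of_int (k $ r)\<bar>"
  have "1 \<le> \<bar>real_of_int (k $ r)\<bar>" using r by linarith
  then have t: "0 \<le> t" "t \<le> 2 * pi" by (auto simp: t_def field_simps)
  have "of_int (k $ r) * t = pi \<or> of_int (k $ r) * t = - pi"
    using r by (auto simp: t_def abs_if)
  then have e: "fchar k (axis r t) = - 1"
    unfolding fchar_axis_right by (elim disjE) (simp_all add: exp_minus)
  have "integral torus_box (fchar k) = integral torus_box (\<lambda>x. fchar k (x + axis r t))"
    using t by (intro integral_torus_translate[symmetric] continuous_on_fchar)
      (simp_all add: periodic_box_def fchar_periodic)
  also have "\<dots> = - integral torus_box (fchar k)"
    by (simp add: fchar_add_right e)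
  finally show ?thesis using False by simp
qed

section \<open>Decay of Fourier coefficients\<close>

definition fourier_coeff :: "(real^'m \<Rightarrow> complex) \<Rightarrow> int^'m \<Rightarrow> complex"
  where "fourier_coeff G k = integral torus_box (\<lambda>x. G x * fchar (- k) x) / (2 * of_real pi) ^ CARD('m)"

lemma Cinf_on_frechet_derivative:
  assumes "Cinf_on UNIV G"
  shows "Cinf_on UNIV (\<lambda>x. frechet_derivative G (at x) v)"
  unfolding Cinf_on_def
proof
  fix k
  have "Ck_on (Suc k) UNIV G" using assms unfolding Cinf_on_def by blast
  then show "Ck_on k UNIV (\<lambda>x. frechet_derivative G (at x) v)" by simp
qed

lemma Cinf_on_continuous: "Cinf_on U G \<Longrightarrow> continuous_on U G"
  unfolding Cinf_on_def by (metis Ck_on.simps(1))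

lemma Cinf_on_has_derivative:
  assumes "Cinf_on UNIV G"
  shows "(G has_derivative frechet_derivative G (at x)) (at x)"
proof -
  have "Ck_on (Suc 0) UNIV G" using assms unfolding Cinf_on_def by blast
  then have "G differentiable (at x)" by simp
  then show ?thesis by (simp add: frechet_derivative_works)
qed

lemma periodic_box_frechet_derivative:
  assumes "Cinf_on UNIV G" "periodic_box G"
  shows "periodic_box (\<lambda>x. frechet_derivative G (at x) v)"
  unfolding periodic_box_def
proof (intro allI)
  fix x r
  have "((\<lambda>y. G (y + axis r (2 * pi))) has_derivative frechet_derivative G (at (x + axis r (2 * pi)))) (at x)"
    by (rule has_derivative_compose[where f = "\<lambda>y. y + axis r (2 * pi)" and f' = "\<lambda>v. v", OF _ Cinf_on_has_derivative[OF assms(1)]])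
      (auto intro!: derivative_eq_intros)
  moreover have "(\<lambda>y. G (y + axis r (2 * pi))) = G"
    using assms(2) by (auto simp: periodic_box_def)
  ultimately have "frechet_derivative G (at (x + axis r (2 * pi))) = frechet_derivative G (at x)"
    using frechet_derivative_at by metis
  then show "frechet_derivative G (at (x + axis r (2 * pi))) v = frechet_derivative G (at x) v" by simp
qed

lemma axis_eq_scaleR: "axis r t = t *\<^sub>R (axis r 1 :: real^'m)"
  by (auto simp: vec_eq_iff axis_def)

text \<open>This is integration by parts, obtained by computing the derivative of \<open>?J\<close>
  at 0 in two ways. Moving the shift onto the character by translation invariance gives an explicit
  exponential times \<open>?I\<close>; differentiating under the integral sign gives the left-hand
  side.\<close>

lemma integral_derivative_fchar:
  fixes G :: "real^'m \<Rightarrow> complex"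
  assumes G: "Cinf_on UNIV G" and per: "periodic_box G"
  shows "integral torus_box (\<lambda>x. frechet_derivative G (at x) (axis r 1) * fchar (- k) x) =
    \<i> * of_int (k $ r) * integral torus_box (\<lambda>x. G x * fchar (- k) x)"
proof -
  define e :: "real^'m" where "e = axis r 1"
  have ax: "axis r t = t *\<^sub>R e" for t unfolding e_def by (rule axis_eq_scaleR)
  let ?D = "\<lambda>x. frechet_derivative G (at x) e"
  let ?I = "integral torus_box (\<lambda>x. G x * fchar (- k) x)"
  let ?J = "\<lambda>t. integral torus_box (\<lambda>x. G (x + axis r t) * fchar (- k) x)"
  note cG = Cinf_on_continuous[OF G]
  note cD = Cinf_on_continuous[OF Cinf_on_frechet_derivative[OF G]]
  have J: "?J t = exp (\<i> * of_real (of_int (k $ r) * t)) * ?I" if "t \<in> cbox 0 1" for t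
  proof -
    have "1 \<le> 2 * pi" using pi_ge_two by linarith
    then have t: "0 \<le> t" "t \<le> 2 * pi" using that by auto
    have eq: "G (x + axis r t) * fchar (- k) x =
        fchar k (axis r t) * (G (x + axis r t) * fchar (- k) (x + axis r t))" for x
      by (simp add: fchar_add_right mult.left_commute)
    have "?J t = fchar k (axis r t) * integral torus_box (\<lambda>x. G (x + axis r t) * fchar (- k) (x + axis r t))"
      unfolding eq by (rule Henstock_Kurzweil_Integration.integral_mult_right)
    also have "integral torus_box (\<lambda>x. G (x + axis r t) * fchar (- k) (x + axis r t)) = ?I"
      using t per by (intro integral_torus_translate[where f = "\<lambda>x. G x * fchar (- k) x"] continuous_intros cG)
        (auto simp: periodic_box_def fchar_periodic)
    finally show ?thesis by (simp add: fchar_axis_right)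
  qed
  have "((\<lambda>t. integral (cbox (\<chi> r. - pi) (\<chi> r. pi)) (\<lambda>x. G (x + axis r t) * fchar (- k) x)) has_vector_derivative
      integral (cbox (\<chi> r. - pi) (\<chi> r. pi)) (\<lambda>x. ?D (x + axis r 0) * fchar (- k) x)) (at 0 within cbox 0 1)"
  proof (rule leibniz_rule_vector_derivative)
    fix t :: real and x :: "real^'m"
    have "((\<lambda>t. G (x + axis r t)) has_derivative (\<lambda>h. frechet_derivative G (at (x + axis r t)) (h *\<^sub>R e))) (at t)"
      by (rule has_derivative_compose[where f = "\<lambda>t. x + axis r t", OF _ Cinf_on_has_derivative[OF G]])
        (auto simp: ax intro!: derivative_eq_intros)
    moreover have "frechet_derivative G (at y) (h *\<^sub>R e) = h *\<^sub>R frechet_derivative G (at y) e" for y h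
      by (intro linear_scale has_derivative_linear[OF Cinf_on_has_derivative[OF G]])
    ultimately have "((\<lambda>t. G (x + axis r t)) has_vector_derivative ?D (x + axis r t)) (at t)"
      by (simp add: has_vector_derivative_def)
    then show "((\<lambda>t. G (x + axis r t) * fchar (- k) x) has_vector_derivative
        ?D (x + axis r t) * fchar (- k) x) (at t within cbox 0 1)"
      by (rule has_vector_derivative_mult_left[OF has_vector_derivative_at_within])
  next
    fix t :: real
    show "(\<lambda>x. G (x + axis r t) * fchar (- k) x) integrable_on cbox (\<chi> r. - pi) (\<chi> r. pi)"
      by (intro integrable_continuous continuous_intros continuous_on_compose2[OF cG]) auto
  next
    have "continuous_on (cbox 0 1 \<times> cbox (\<chi> r. - pi) (\<chi> r. pi))
        (\<lambda>p. ?D (snd p + fst p *\<^sub>R e) * fchar (- k) (snd p))"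
      by (intro continuous_intros continuous_on_compose2[OF cD] continuous_on_compose2[OF continuous_on_fchar[of UNIV]]) auto
    then show "continuous_on (cbox 0 1 \<times> cbox (\<chi> r. - pi) (\<chi> r. pi))
        (\<lambda>(t, x). ?D (x + axis r t) * fchar (- k) x)"
      by (simp add: case_prod_unfold ax)
  qed auto
  then have "(?J has_vector_derivative integral torus_box (\<lambda>x. ?D x * fchar (- k) x)) (at 0 within cbox 0 1)"
    by (simp add: torus_box_def ax)
  then have 1: "((\<lambda>t. exp (\<i> * of_real (of_int (k $ r) * t)) * ?I) has_vector_derivative
      integral torus_box (\<lambda>x. ?D x * fchar (- k) x)) (at 0 within cbox 0 1)"
    by (rule has_vector_derivative_transform[rotated 2]) (auto simp: J)
  have "((\<lambda>z. exp (\<i> * (of_int (k $ r) * z)) * ?I) has_field_derivative (\<i> * of_int (k $ r) * ?I)) (at (of_real 0))"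
    by (auto intro!: derivative_eq_intros)
  from has_vector_derivative_real_field[OF this, of "cbox 0 1"]
  have 2: "((\<lambda>t. exp (\<i> * of_real (of_int (k $ r) * t)) * ?I) has_vector_derivative
      \<i> * of_int (k $ r) * ?I) (at 0 within cbox 0 1)"
    by simp
  \<comment> \<open>Translation invariance was proved for nonnegative shifts only, so both
    derivatives are one-sided at the left endpoint of the unit interval, where they are still
    unique.\<close>
  show ?thesis
    unfolding e_def[symmetric] by (rule vector_derivative_unique_within_closed_interval[OF _ _ 1 2]) auto
qed

text \<open>Each power of \<open>k $ r\<close> is paid for by one derivative in direction
  \<open>r\<close>. The derivative is again smooth and periodic, hence the induction over all
  \<open>G\<close>.\<close>

lemma integral_fchar_decay:
  fixes G :: "real^'m \<Rightarrow> complex"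
  assumes "Cinf_on UNIV G" "periodic_box G"
  shows "\<exists>C. \<forall>k. \<bar>of_int (k $ r)\<bar> ^ p * cmod (integral torus_box (\<lambda>x. G x * fchar (- k) x)) \<le> C"
  using assms
proof (induction p arbitrary: G)
  case 0
  have cG: "continuous_on torus_box G"
    using Cinf_on_continuous[OF 0(1)] continuous_on_subset by blast
  then have "bounded (G ` torus_box)"
    by (intro compact_imp_bounded compact_continuous_image) auto
  then obtain B where B: "0 \<le> B" "\<And>x. x \<in> torus_box \<Longrightarrow> cmod (G x) \<le> B"
    by (metis bounded_pos imageI less_imp_le)
  have "cmod (integral torus_box (\<lambda>x. G x * fchar (- k) x)) \<le> B * measure lborel (torus_box :: (real^'m) set)" for k
  proof -
    have "(\<lambda>x. G x * fchar (- k) x) integrable_on torus_box"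
      by (intro integrable_continuous_on_compact continuous_intros cG) auto
    then show ?thesis
      using B unfolding torus_box_def
      by (intro has_integral_bound[OF _ integrable_integral]) (auto simp: norm_mult)
  qed
  then show ?case by auto
next
  case (Suc p)
  let ?D = "\<lambda>x. frechet_derivative G (at x) (axis r 1)"
  obtain C where C: "\<bar>of_int (k $ r)\<bar> ^ p * cmod (integral torus_box (\<lambda>x. ?D x * fchar (- k) x)) \<le> C" for k
    using Suc.IH[OF Cinf_on_frechet_derivative[OF Suc.prems(1)] periodic_box_frechet_derivative[OF Suc.prems]]
    by blast
  have "\<bar>of_int (k $ r)\<bar> ^ Suc p * cmod (integral torus_box (\<lambda>x. G x * fchar (- k) x)) \<le> C" for k
    using C[of k] unfolding integral_derivative_fchar[OF Suc.prems] by (simp add: norm_mult mult_ac)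
  then show ?case by blast
qed

text \<open>The maximum with 1 keeps reciprocals meaningful for modes with a zero component.\<close>

definition freq_weight :: "int \<Rightarrow> real"
  where "freq_weight j = max 1 \<bar>of_int j\<bar>"

lemma freq_weight_ge_1: "1 \<le> freq_weight j"
  by (simp add: freq_weight_def)

lemma freq_weight_pos: "0 < freq_weight j"
  using freq_weight_ge_1[of j] by linarith

text \<open>The product makes the bound summable over the lattice; the last factor, in a coordinate
  \<open>s\<close> that may be chosen afterwards for each \<open>k\<close>, provides the rate. Both
  are dominated by the largest weight alone, which explains the exponent
  \<open>2 * CARD('m) + p\<close>: two powers for each coordinate and \<open>p\<close> more.\<close>

lemma fourier_coeff_decay:
  fixes G :: "real^'m \<Rightarrow> complex"
  assumes "Cinf_on UNIV G" "periodic_box G"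
  obtains C where "0 \<le> C"
    "\<And>k s. cmod (fourier_coeff G k) \<le>
      C * (\<Prod>r\<in>UNIV. inverse (freq_weight (k $ r) ^ 2)) * inverse (freq_weight (k $ s) ^ p)"
proof -
  let ?N = "2 * CARD('m) + p"
  let ?I = "\<lambda>k. integral torus_box (\<lambda>x. G x * fchar (- k) x)"
  have "\<exists>B. \<forall>k. freq_weight (k $ r) ^ ?N * cmod (?I k) \<le> B" for r
  proof -
    \<comment> \<open>The bound with exponent 0 serves the modes whose weight is 1, in particular
      \<open>k $ r = 0\<close>, where the other bound says nothing.\<close>
    obtain B0 where B0: "\<And>k. \<bar>of_int (k $ r)\<bar> ^ 0 * cmod (?I k) \<le> B0"
      using integral_fchar_decay[OF assms, of r 0] by blast
    obtain B1 where B1: "\<And>k. \<bar>of_int (k $ r)\<bar> ^ ?N * cmod (?I k) \<le> B1"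
      using integral_fchar_decay[OF assms, of r ?N] by blast
    have "freq_weight (k $ r) ^ ?N * cmod (?I k) \<le> max B0 B1" for k
      using B0[of k] B1[of k] by (auto simp: freq_weight_def max_def)
    then show ?thesis by blast
  qed
  then obtain B where B: "\<And>r k. freq_weight (k $ r) ^ ?N * cmod (?I k) \<le> B r" by metis
  have B0: "0 \<le> B r" for r
    using B[of 0 r] freq_weight_pos[of "0 $ r"]
    by (meson order_trans mult_nonneg_nonneg norm_ge_zero zero_le_power less_imp_le)
  define C where "C = (\<Sum>r\<in>UNIV. B r) / (2 * pi) ^ CARD('m)"
  have main: "cmod (?I k) \<le> (\<Sum>r\<in>UNIV. B r) * (\<Prod>r\<in>UNIV. inverse (freq_weight (k $ r) ^ 2)) * inverse (freq_weight (k $ s) ^ p)" for k s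
  proof -
    let ?w = "\<lambda>r. freq_weight (k $ r)"
    obtain t where t: "\<And>r. ?w r \<le> ?w t"
    proof -
      have fin: "finite (range ?w)" by simp
      then have "Max (range ?w) \<in> range ?w" by (rule Max_in) auto
      then obtain t where "Max (range ?w) = ?w t" by blast
      then have "?w r \<le> ?w t" for r using Max_ge[OF fin, of "?w r"] by auto
      then show ?thesis by (rule that)
    qed
    have P: "0 < (\<Prod>r\<in>UNIV. ?w r ^ 2) * ?w s ^ p"
      by (intro mult_pos_pos prod_pos zero_less_power freq_weight_pos ballI)
    have "(\<Prod>r\<in>UNIV. ?w r ^ 2) * ?w s ^ p \<le> (\<Prod>r\<in>(UNIV :: 'm set). ?w t ^ 2) * ?w t ^ p"
      using t freq_weight_pos less_imp_le
      by (intro mult_mono prod_mono power_mono conjI zero_le_power prod_nonneg) (auto intro: less_imp_le)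
    also have "\<dots> = ?w t ^ ?N" by (simp add: power_add power_mult)
    finally have "(\<Prod>r\<in>UNIV. ?w r ^ 2) * ?w s ^ p * cmod (?I k) \<le> ?w t ^ ?N * cmod (?I k)"
      by (intro mult_right_mono) auto
    also have "\<dots> \<le> B t" by (rule B)
    also have "\<dots> \<le> (\<Sum>r\<in>UNIV. B r)" using B0 by (intro member_le_sum) auto
    finally have "cmod (?I k) \<le> (\<Sum>r\<in>UNIV. B r) / ((\<Prod>r\<in>UNIV. ?w r ^ 2) * ?w s ^ p)"
      using P by (simp add: pos_le_divide_eq mult.commute)
    moreover have "(\<Prod>r\<in>UNIV. inverse (?w r ^ 2)) = inverse (\<Prod>r\<in>UNIV. ?w r ^ 2)"
      using prod_inversef[of "\<lambda>r. ?w r ^ 2" UNIV] by (simp add: comp_def)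
    ultimately show ?thesis by (simp add: divide_inverse mult.assoc)
  qed
  have "cmod (fourier_coeff G k) \<le>
      C * (\<Prod>r\<in>UNIV. inverse (freq_weight (k $ r) ^ 2)) * inverse (freq_weight (k $ s) ^ p)" for k s
  proof -
    have "cmod (fourier_coeff G k) = cmod (?I k) / (2 * pi) ^ CARD('m)"
      by (simp add: fourier_coeff_def norm_divide norm_power norm_mult)
    also have "\<dots> \<le> ((\<Sum>r\<in>UNIV. B r) * (\<Prod>r\<in>UNIV. inverse (freq_weight (k $ r) ^ 2)) * inverse (freq_weight (k $ s) ^ p)) / (2 * pi) ^ CARD('m)"
      by (intro divide_right_mono main) simp
    finally show ?thesis by (simp add: C_def)
  qed
  moreover have "0 \<le> C" unfolding C_def using B0 by (intro divide_nonneg_nonneg sum_nonneg) auto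
  ultimately show ?thesis by (intro that)
qed

section \<open>Summation over the frequency lattice and termwise integration\<close>

lemma summable_on_freq_weight: "(\<lambda>j. inverse (freq_weight j ^ 2)) summable_on UNIV"
proof -
  let ?g = "\<lambda>j. inverse (freq_weight j ^ 2)"
  have "summable (\<lambda>n. ?g (int n))"
  proof (rule summable_cong[THEN iffD2])
    show "\<forall>\<^sub>F n in sequentially. ?g (int n) = inverse (real n ^ 2)"
      using eventually_ge_at_top[of 1] by eventually_elim (simp add: freq_weight_def max_def)
  qed (simp add: inverse_power_summable)
  then have nat: "(\<lambda>n. ?g (int n)) summable_on UNIV"
    by (subst summable_on_UNIV_nonneg_real_iff) (auto simp: freq_weight_pos less_imp_le)
  have "?g summable_on range int"
    using nat by (subst summable_on_reindex) (auto simp: comp_def inj_on_def)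
  moreover have "?g summable_on range (\<lambda>n. - int n)"
    using nat by (subst summable_on_reindex) (auto simp: comp_def inj_on_def freq_weight_def)
  ultimately have "?g summable_on (range int \<union> range (\<lambda>n. - int n))"
    by (rule summable_on_union)
  moreover have "range int \<union> range (\<lambda>n. - int n) = UNIV"
  proof (rule UNIV_eq_I[symmetric])
    fix j :: int
    show "j \<in> range int \<union> range (\<lambda>n. - int n)" by (cases j rule: int_cases2) auto
  qed
  ultimately show ?thesis by simp
qed

text \<open>A finite set of frequencies lies in the product of its coordinate projections, and over
  a product set the sum factors into one-dimensional sums.\<close>

lemma summable_on_prod_freq_weight:
  "(\<lambda>k :: int^'m. \<Prod>r\<in>UNIV. inverse (freq_weight (k $ r) ^ 2)) summable_on UNIV"
proof (rule nonneg_bdd_above_summable_on)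
  let ?g = "\<lambda>j. inverse (freq_weight j ^ 2)"
  have g0: "0 \<le> ?g j" for j using freq_weight_pos[of j] by simp
  show "0 \<le> (\<Prod>r\<in>UNIV. ?g (k $ r))" for k :: "int^'m"
    by (intro prod_nonneg g0 ballI)
  have "(\<Sum>k\<in>A. \<Prod>r\<in>UNIV. ?g (k $ r)) \<le> (infsum ?g UNIV) ^ CARD('m)" if "finite A" for A :: "(int^'m) set"
  proof -
    let ?B = "\<lambda>r. (\<lambda>k. k $ r) ` A"
    have "(\<Sum>k\<in>A. \<Prod>r\<in>UNIV. ?g (k $ r)) \<le> (\<Sum>k\<in>vec_lambda ` (Pi\<^sub>E UNIV ?B). \<Prod>r\<in>UNIV. ?g (k $ r))"
    proof (rule sum_mono2)
      show "finite (vec_lambda ` (Pi\<^sub>E UNIV ?B))" using that by (intro finite_imageI finite_PiE) auto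
      show "A \<subseteq> vec_lambda ` (Pi\<^sub>E UNIV ?B)"
      proof
        fix k assume "k \<in> A"
        then show "k \<in> vec_lambda ` (Pi\<^sub>E UNIV ?B)"
          by (intro image_eqI[of _ _ "vec_nth k"]) auto
      qed
    qed (intro prod_nonneg g0 ballI)
    also have "\<dots> = (\<Sum>h\<in>Pi\<^sub>E UNIV ?B. \<Prod>r\<in>UNIV. ?g (h r))"
      by (subst sum.reindex) (auto simp: inj_on_def vec_lambda_inject)
    also have "\<dots> = (\<Prod>r\<in>UNIV. \<Sum>j\<in>?B r. ?g j)"
      using that by (subst prod_sum_PiE) auto
    also have "\<dots> \<le> (\<Prod>r\<in>(UNIV::'m set). infsum ?g UNIV)"
      using that g0 by (intro prod_mono conjI sum_nonneg finite_sum_le_infsum summable_on_freq_weight) auto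
    finally show ?thesis by simp
  qed
  then show "bdd_above (sum (\<lambda>k :: int^'m. \<Prod>r\<in>UNIV. ?g (k $ r)) ` {F. F \<subseteq> UNIV \<and> finite F})"
    by (intro bdd_aboveI2[where M = "(infsum ?g UNIV) ^ CARD('m)"]) auto
qed

lemma has_sum_integral_dominated:
  fixes u :: "'k \<Rightarrow> 'a::euclidean_space \<Rightarrow> 'b::euclidean_space"
  assumes S: "compact S" and u: "\<And>k. continuous_on S (u k)"
    and le: "\<And>k x. x \<in> S \<Longrightarrow> norm (u k x) \<le> M k" and M: "M summable_on A"
  shows "((\<lambda>k. integral S (u k)) has_sum integral S (\<lambda>x. \<Sum>\<^sub>\<infinity>k\<in>A. u k x)) A"
    and "continuous_on S (\<lambda>x. \<Sum>\<^sub>\<infinity>k\<in>A. u k x)"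
proof -
  let ?F = "finite_subsets_at_top A" and ?l = "\<lambda>x. \<Sum>\<^sub>\<infinity>k\<in>A. u k x"
  have ul: "uniform_limit S (\<lambda>X x. \<Sum>k\<in>X. u k x) ?l ?F"
    using le M by (intro Weierstrass_m_test_general) auto
  then show cl: "continuous_on S ?l"
    by (rule uniform_limit_theorem[rotated]) (auto intro!: always_eventually continuous_intros u)
  have lm: "S \<in> lmeasurable" using S by (rule lmeasurable_compact)
  show "((\<lambda>k. integral S (u k)) has_sum integral S ?l) A"
    unfolding has_sum_def
  proof (rule tendstoI)
    fix \<epsilon> :: real assume "0 < \<epsilon>"
    \<comment> \<open>The added 1 allows \<open>S\<close> to be null and makes the final estimate
      strict.\<close>
    define \<delta> where "\<delta> = \<epsilon> / (measure lebesgue S + 1)"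
    have pos: "0 < measure lebesgue S + 1" by (simp add: add_nonneg_pos)
    then have "0 < \<delta>" using \<open>0 < \<epsilon>\<close> by (simp add: \<delta>_def)
    from uniform_limitD[OF ul this]
    show "\<forall>\<^sub>F X in ?F. dist (\<Sum>k\<in>X. integral S (u k)) (integral S ?l) < \<epsilon>"
    proof (rule eventually_rev_mp[OF eventually_conj[OF _ eventually_finite_subsets_at_top_weakI]])
      show "finite X \<Longrightarrow> X \<subseteq> A \<Longrightarrow> finite X" for X by simp
      show "\<forall>\<^sub>F X in ?F. (\<forall>x\<in>S. dist (\<Sum>k\<in>X. u k x) (?l x) < \<delta>) \<and> finite X \<longrightarrow>
          dist (\<Sum>k\<in>X. integral S (u k)) (integral S ?l) < \<epsilon>"
      proof (intro always_eventually allI impI, elim conjE)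
        fix X assume X: "\<forall>x\<in>S. dist (\<Sum>k\<in>X. u k x) (?l x) < \<delta>" "finite X"
        have i: "(\<lambda>x. \<Sum>k\<in>X. u k x) integrable_on S" "?l integrable_on S"
          using cl u S by (auto intro!: integrable_continuous_on_compact continuous_intros)
        have "(\<Sum>k\<in>X. integral S (u k)) = integral S (\<lambda>x. \<Sum>k\<in>X. u k x)"
          using X(2) S u by (intro Henstock_Kurzweil_Integration.integral_sum[symmetric] integrable_continuous_on_compact) auto
        then have "dist (\<Sum>k\<in>X. integral S (u k)) (integral S ?l) = norm (integral S (\<lambda>x. (\<Sum>k\<in>X. u k x) - ?l x))"
          using i by (simp add: dist_norm Henstock_Kurzweil_Integration.integral_diff)
        also have "\<dots> \<le> integral S (\<lambda>x. \<delta>)"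
          using i X lm by (intro Henstock_Kurzweil_Integration.integral_norm_bound_integral
              Henstock_Kurzweil_Integration.integrable_diff integrable_on_const) (auto simp: dist_norm less_imp_le)
        also have "\<dots> = \<delta> * measure lebesgue S"
          using Henstock_Kurzweil_Integration.integral_mult_right[of S \<delta> "\<lambda>x. 1"] by (simp add: lmeasure_integral[OF lm])
        also have "\<dots> < \<epsilon>"
          using \<open>0 < \<epsilon>\<close> pos by (simp add: \<delta>_def field_simps)
        finally show "dist (\<Sum>k\<in>X. integral S (u k)) (integral S ?l) < \<epsilon>" .
      qed
    qed
  qed
qed

section \<open>Completeness of the trigonometric system\<close>

inductive trig_poly :: "(real^'m \<Rightarrow> complex) \<Rightarrow> bool" where
  trig_poly_fchar: "trig_poly (fchar k)"
| trig_poly_add: "trig_poly f \<Longrightarrow> trig_poly g \<Longrightarrow> trig_poly (\<lambda>x. f x + g x)"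
| trig_poly_scale: "trig_poly f \<Longrightarrow> trig_poly (\<lambda>x. c * f x)"

lemma trig_poly_const: "trig_poly (\<lambda>x. c)"
  using trig_poly_scale[OF trig_poly_fchar[of 0], of c] by simp

lemma trig_poly_sum: "finite A \<Longrightarrow> (\<And>r. r \<in> A \<Longrightarrow> trig_poly (f r)) \<Longrightarrow> trig_poly (\<lambda>x. \<Sum>r\<in>A. f r x)"
  by (induction A rule: finite_induct) (auto intro: trig_poly_const trig_poly_add)

lemma trig_poly_mult:
  assumes "trig_poly f" "trig_poly g"
  shows "trig_poly (\<lambda>x. f x * g x)"
  using assms(1)
proof induction
  case (trig_poly_fchar k)
  from assms(2) show ?case
  proof induction
    case (trig_poly_fchar l)
    have "(\<lambda>x. fchar k x * fchar l x) = fchar (k + l)" by (simp add: fchar_add_left fun_eq_iff)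
    then show ?case by (simp add: trig_poly.trig_poly_fchar)
  next
    case (trig_poly_scale f c)
    then show ?case using trig_poly.trig_poly_scale[of "\<lambda>x. fchar k x * f x" c] by (simp add: mult_ac)
  qed (auto simp: distrib_left intro: trig_poly.trig_poly_add)
next
  case (trig_poly_scale f c)
  then show ?case using trig_poly.trig_poly_scale[of "\<lambda>x. f x * g x" c] by (simp add: mult_ac)
qed (auto simp: distrib_right intro: trig_poly.trig_poly_add)

lemma trig_poly_continuous: "trig_poly f \<Longrightarrow> continuous_on S f"
  by (induction rule: trig_poly.induct) (auto intro!: continuous_intros)

text \<open>Identifies opposite faces of the box: periodic functions become functions on a compact
  subset of C^m, and polynomials there pull back to trigonometric polynomials.\<close>

definition torus_map :: "real^'m \<Rightarrow> complex^'m"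
  where "torus_map x = (\<chi> r. exp (\<i> * of_real (x $ r)))"

lemma torus_map_fchar: "torus_map x $ r = fchar (axis r 1) x"
  by (simp add: torus_map_def fchar_def freq_dot_axis_left)

lemma cnj_fchar: "cnj (fchar k x) = fchar (- k) x"
  by (simp add: fchar_def freq_dot_minus_left exp_cnj)

lemma bounded_linear_cvec_expand:
  fixes f :: "complex^'m \<Rightarrow> real"
  assumes "bounded_linear f"
  shows "f z = (\<Sum>r\<in>UNIV. Re (z $ r) * f (axis r 1) + Im (z $ r) * f (axis r \<i>))"
proof -
  interpret bounded_linear f by fact
  have z: "z = (\<Sum>r\<in>UNIV. Re (z $ r) *\<^sub>R axis r 1 + Im (z $ r) *\<^sub>R axis r \<i>)"
  proof (subst vec_eq_iff, intro allI)
    fix s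
    have "(\<Sum>r\<in>UNIV. Re (z $ r) *\<^sub>R axis r 1 + Im (z $ r) *\<^sub>R axis r \<i>) $ s =
        (\<Sum>r\<in>UNIV. if r = s then z $ s else 0)"
      unfolding sum_component by (intro sum.cong) (auto simp: axis_def complex_eq_iff)
    then show "z $ s = (\<Sum>r\<in>UNIV. Re (z $ r) *\<^sub>R axis r 1 + Im (z $ r) *\<^sub>R axis r \<i>) $ s" by simp
  qed
  show ?thesis by (subst z) (simp add: sum add scaleR)
qed

text \<open>Only linear functionals need work: a real-linear functional is a combination of real and
  imaginary parts of the coordinates, and these are combinations of a character and its conjugate,
  the character of opposite frequency.\<close>

lemma trig_poly_real_polynomial:
  fixes q :: "complex^'m \<Rightarrow> real"
  assumes "real_polynomial_function q"
  shows "trig_poly (\<lambda>x. of_real (q (torus_map x)))"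
  using assms
proof induction
  case (linear f)
  have "of_real (f (torus_map x)) = (\<Sum>r\<in>UNIV.
      (of_real (f (axis r 1)) / 2 + of_real (f (axis r \<i>)) / (2 * \<i>)) * fchar (axis r 1) x
    + (of_real (f (axis r 1)) / 2 - of_real (f (axis r \<i>)) / (2 * \<i>)) * fchar (- axis r 1) x)" for x
  proof -
    have re: "of_real (Re z) = (z + cnj z) / 2" and im: "of_real (Im z) = (z - cnj z) / (2 * \<i>)" for z
      by (auto simp: complex_eq_iff)
    show ?thesis
      unfolding bounded_linear_cvec_expand[OF linear, of "torus_map x"] of_real_sum
      by (intro sum.cong) (simp_all add: re im torus_map_fchar cnj_fchar field_simps)
  qed
  then show ?case
    by (auto intro!: trig_poly_sum trig_poly_add trig_poly_scale trig_poly_fchar)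
qed (auto intro: trig_poly_const trig_poly_add trig_poly_mult)

lemma trig_poly_polynomial:
  fixes q :: "complex^'m \<Rightarrow> complex"
  assumes "polynomial_function q"
  shows "trig_poly (\<lambda>x. q (torus_map x))"
proof -
  have "real_polynomial_function (Re \<circ> q)" "real_polynomial_function (Im \<circ> q)"
    using assms bounded_linear_Re bounded_linear_Im unfolding polynomial_function_def by blast+
  then have "trig_poly (\<lambda>x. of_real ((Re \<circ> q) (torus_map x)) + \<i> * of_real ((Im \<circ> q) (torus_map x)))"
    by (intro trig_poly_add trig_poly_scale trig_poly_real_polynomial)
  moreover have "of_real ((Re \<circ> q) z) + \<i> * of_real ((Im \<circ> q) z) = q z" for z
    by (simp add: complex_eq_iff)
  ultimately show ?thesis by simp
qed

section \<open>Periodic functions as functions on the torus\<close>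

lemma periodic_box_int:
  assumes "periodic_box G"
  shows "G (x + axis r (2 * pi * of_int j)) = G x"
proof -
  have nat: "G (x + axis r (2 * pi * real n)) = G x" for n x
  proof (induction n)
    case (Suc n)
    have eq: "x + axis r (2 * pi * real (Suc n)) = (x + axis r (2 * pi * real n)) + axis r (2 * pi)"
      by (auto simp: vec_eq_iff axis_def algebra_simps)
    show ?case
      by (simp only: eq Suc.IH assms[unfolded periodic_box_def, rule_format, of "x + axis r (2 * pi * real n)" r])
  next
    case 0
    have eq: "x + axis r (2 * pi * real 0) = x" by (simp add: vec_eq_iff axis_def)
    show ?case by (simp only: eq)
  qed
  show ?thesis
  proof (cases j rule: int_cases2)
    case (nonneg n)
    then show ?thesis using nat by simp
  next
    case (nonpos n)
    have eq: "x + axis r (2 * pi * of_int j) + axis r (2 * pi * real n) = x"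
      using nonpos by (auto simp: vec_eq_iff axis_def)
    show ?thesis using nat[of "x + axis r (2 * pi * of_int j)" n] unfolding eq by (rule sym)
  qed
qed

text \<open>Fibres of \<open>torus_map\<close> are cosets of the period lattice; the difference of
  two points in a fibre is removed one coordinate at a time.\<close>

lemma periodic_box_torus_map:
  fixes G :: "real^'m \<Rightarrow> 'b"
  assumes G: "periodic_box G" and eq: "torus_map x = torus_map y"
  shows "G x = G y"
proof -
  have "\<exists>j::int. x $ r = y $ r + 2 * pi * of_int j" for r
  proof -
    have "exp (\<i> * of_real (x $ r)) = exp (\<i> * of_real (y $ r))"
      using eq by (simp add: torus_map_def vec_eq_iff)
    then obtain j where "\<i> * of_real (x $ r) = \<i> * of_real (y $ r) + (of_int (2 * j) * pi) * \<i>"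
      unfolding exp_eq by blast
    then have "of_real (x $ r) = (of_real (y $ r + 2 * pi * of_int j) :: complex)"
      by (auto simp: complex_eq_iff)
    then show ?thesis unfolding of_real_eq_iff by blast
  qed
  then obtain j :: "'m \<Rightarrow> int" where j: "\<And>r. x $ r = y $ r + 2 * pi * of_int (j r)" by metis
  have "G (y + (\<Sum>r\<in>A. axis r (2 * pi * of_int (j r)))) = G y" if "finite A" for A
    using that
  proof (induction A rule: finite_induct)
    case (insert r A)
    then show ?case
      using periodic_box_int[OF G, of "y + (\<Sum>r\<in>A. axis r (2 * pi * of_int (j r)))" r "j r"]
      by (simp add: add_ac)
  qed simp
  from this[of UNIV] have "G (y + (\<Sum>r\<in>UNIV. axis r (2 * pi * of_int (j r)))) = G y" by simp
  moreover have "y + (\<Sum>r\<in>UNIV. axis r (2 * pi * of_int (j r))) = x"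
    by (auto simp: vec_eq_iff sum_component axis_def j)
  ultimately show ?thesis by simp
qed

lemma trig_poly_dense:
  fixes H :: "real^'m \<Rightarrow> complex"
  assumes cH: "continuous_on UNIV H" and per: "periodic_box H" and "0 < \<epsilon>"
  obtains Q where "trig_poly Q" "\<And>x. x \<in> torus_box \<Longrightarrow> cmod (H x - Q x) < \<epsilon>"
proof -
  let ?T = "torus_map ` (torus_box :: (real^'m) set)"
  \<comment> \<open>The choice of preimage is immaterial because \<open>H\<close> is
    periodic.\<close>
  define h where "h z = H (SOME x. x \<in> torus_box \<and> torus_map x = z)" for z
  have h: "h (torus_map x) = H x" if "x \<in> torus_box" for x
  proof -
    let ?P = "\<lambda>y. y \<in> torus_box \<and> torus_map y = torus_map x"
    have "?P (SOME y. ?P y)" by (rule someI[of ?P x]) (use that in simp)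
    then show ?thesis unfolding h_def by (intro periodic_box_torus_map[OF per]) simp
  qed
  have ct: "continuous_on S (torus_map :: real^'m \<Rightarrow> _)" for S
    unfolding torus_map_def by (intro continuous_intros)
  have cT: "compact ?T" by (intro compact_continuous_image ct) simp
  have "continuous_on ?T h"
  \<comment> \<open>The chosen preimage jumps across identified faces, so continuity is not
    inherited by composition. Instead, the graph of \<open>h\<close> is a continuous image of the
    compact box, hence closed, and \<open>h\<close> takes values in a compact set.\<close>
  proof (rule continuous_from_closed_graph)
    show "compact (H ` torus_box)"
      using cH continuous_on_subset by (blast intro: compact_continuous_image compact_torus_box)
    show "h \<in> ?T \<rightarrow> H ` torus_box" by (auto simp: h)
    have "compact ((\<lambda>x. (torus_map x, H x)) ` torus_box)"
      using continuous_on_subset[OF cH subset_UNIV]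
      by (intro compact_continuous_image continuous_intros ct) auto
    moreover have "(\<lambda>z. (z, h z)) ` ?T = (\<lambda>x. (torus_map x, H x)) ` torus_box"
      by (auto simp: h image_iff)
    ultimately show "closed ((\<lambda>z. (z, h z)) ` ?T)" by (simp add: compact_imp_closed)
  qed
  from Stone_Weierstrass_polynomial_function[OF cT this \<open>0 < \<epsilon>\<close>]
  obtain q where q: "polynomial_function q" "\<forall>z\<in>?T. cmod (h z - q z) < \<epsilon>" by auto
  then show ?thesis
    by (intro that[of "\<lambda>x. q (torus_map x)"] trig_poly_polynomial) (auto simp: h)
qed

text \<open>\<open>H\<close> is orthogonal to all trigonometric polynomials, hence to their uniform
  limits, among them its own conjugate. So the integral of |H|^2 vanishes, and continuity does the
  rest.\<close>

lemma zero_if_fourier_coeff_zero: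
  fixes H :: "real^'m \<Rightarrow> complex"
  assumes cH: "continuous_on UNIV H" and per: "periodic_box H"
    and zero: "\<And>k. integral torus_box (\<lambda>x. H x * fchar k x) = 0" and x: "x \<in> torus_box"
  shows "H x = 0"
proof -
  have cS: "continuous_on S H" for S using cH continuous_on_subset by blast
  have int: "(\<lambda>x. H x * f x) integrable_on torus_box" if "continuous_on UNIV f" for f
    using that continuous_on_subset by (intro integrable_continuous_on_compact continuous_intros cS) auto
  have Q0: "integral torus_box (\<lambda>x. H x * Q x) = 0" if "trig_poly Q" for Q
    using that
  proof induction
    case (trig_poly_add f g)
    then show ?case
      using Henstock_Kurzweil_Integration.integral_add[OF int[OF trig_poly_continuous] int[OF trig_poly_continuous], of f g]
      by (simp add: distrib_left)
  next
    case (trig_poly_scale f c)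
    then show ?case
      using Henstock_Kurzweil_Integration.integral_mult_right[of torus_box c "\<lambda>x. H x * f x"] by (simp add: mult_ac)
  qed (rule zero)
  have "bounded (H ` torus_box)"
    by (intro compact_imp_bounded compact_continuous_image cS) auto
  then obtain B where B: "0 < B" "\<And>x. x \<in> torus_box \<Longrightarrow> cmod (H x) \<le> B"
    by (metis bounded_pos imageI)
  let ?V = "measure lborel (torus_box :: (real^'m) set)"
  have V: "0 < ?V" by (simp add: content_torus_box)
  let ?c = "\<lambda>x. cnj (H x)"
  have cc: "continuous_on UNIV ?c" by (intro continuous_intros cH)
  have "cmod (integral torus_box (\<lambda>x. H x * ?c x)) \<le> \<eta>" if "0 < \<eta>" for \<eta>
  proof -
    define \<epsilon> where "\<epsilon> = \<eta> / (B * ?V)"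
    have "0 < \<epsilon>" using that B V by (simp add: \<epsilon>_def)
    then obtain Q where Q: "trig_poly Q" "\<And>x. x \<in> torus_box \<Longrightarrow> cmod (?c x - Q x) < \<epsilon>"
      using trig_poly_dense[OF cc, of \<epsilon>] per by (auto simp: periodic_box_def)
    have "integral torus_box (\<lambda>x. H x * ?c x) = integral torus_box (\<lambda>x. H x * (?c x - Q x))"
      using Henstock_Kurzweil_Integration.integral_diff[OF int[OF cc] int[OF trig_poly_continuous[OF Q(1)]]] Q0[OF Q(1)]
      by (simp add: right_diff_distrib)
    moreover have "cmod (integral torus_box (\<lambda>x. H x * (?c x - Q x))) \<le> (B * \<epsilon>) * ?V"
      unfolding torus_box_def
    proof (rule has_integral_bound[OF _ integrable_integral])
      show "0 \<le> B * \<epsilon>" using B \<open>0 < \<epsilon>\<close> by simp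
      have "continuous_on UNIV (\<lambda>x. ?c x - Q x)"
        by (intro continuous_intros cH trig_poly_continuous Q(1))
      then show "(\<lambda>x. H x * (?c x - Q x)) integrable_on cbox (\<chi> r. - pi) (\<chi> r. pi)"
        using int[of "\<lambda>x. ?c x - Q x"] by (simp add: torus_box_def)
      fix x :: "real^'m" assume "x \<in> cbox (\<chi> r. - pi) (\<chi> r. pi)"
      then show "cmod (H x * (?c x - Q x)) \<le> B * \<epsilon>"
        using B(2)[of x] Q(2)[of x] B(1) unfolding norm_mult torus_box_def
        by (intro mult_mono) auto
    qed
    moreover have "(B * \<epsilon>) * ?V = \<eta>" using B V by (simp add: \<epsilon>_def)
    ultimately show ?thesis by simp
  qed
  then have "cmod (integral torus_box (\<lambda>x. H x * ?c x)) \<le> 0"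
    by (rule field_le_epsilon) simp
  then have "integral torus_box (\<lambda>x. H x * ?c x) = 0" by (simp only: norm_le_zero_iff)
  moreover have "(\<lambda>x. H x * ?c x) = (\<lambda>x. of_real ((cmod (H x))\<^sup>2))"
    by (intro ext) (rule complex_norm_square[symmetric])
  ultimately have "integral torus_box (\<lambda>x. of_real ((cmod (H x))\<^sup>2) :: complex) = 0" by simp
  moreover have sq: "continuous_on torus_box (\<lambda>x. (cmod (H x))\<^sup>2)" by (intro continuous_intros cS)
  then have "integral torus_box (\<lambda>x. of_real ((cmod (H x))\<^sup>2) :: complex) =
      of_real (integral torus_box (\<lambda>x. (cmod (H x))\<^sup>2))"
    using integral_linear[OF integrable_continuous_on_compact bounded_linear_of_real, of torus_box "\<lambda>x. (cmod (H x))\<^sup>2"]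
    by (simp add: comp_def)
  ultimately have "integral torus_box (\<lambda>x. (cmod (H x))\<^sup>2) = 0" by simp
  then have "\<forall>x\<in>torus_box. (cmod (H x))\<^sup>2 = 0"
    using sq unfolding torus_box_def
    by (subst (asm) integral_cbox_eq_0_iff) (auto simp: interval_ne_empty_cart)
  then show ?thesis using x by simp
qed

section \<open>Fourier expansion of smooth periodic functions\<close>

lemma fourier_coeff_summable:
  fixes G :: "real^'m \<Rightarrow> complex"
  assumes "Cinf_on UNIV G" "periodic_box G"
  shows "(\<lambda>k. cmod (fourier_coeff G k)) summable_on UNIV"
proof -
  obtain C where "\<And>k s. cmod (fourier_coeff G k) \<le>
      C * (\<Prod>r\<in>UNIV. inverse (freq_weight (k $ r) ^ 2)) * inverse (freq_weight (k $ s) ^ 0)"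
    using fourier_coeff_decay[OF assms] by metis
  then have "\<And>k. cmod (fourier_coeff G k) \<le> C * (\<Prod>r\<in>UNIV. inverse (freq_weight (k $ r) ^ 2))" by simp
  then show ?thesis
    by (intro summable_on_comparison_test[OF summable_on_cmult_right[OF summable_on_prod_freq_weight]]) auto
qed

text \<open>Absolute summability makes the series \<open>?S\<close> continuous and periodic and
  permits termwise integration. By orthogonality it then has the same Fourier coefficients as
  \<open>G\<close>, so completeness applies to the difference.\<close>

lemma fourier_expansion:
  fixes G :: "real^'m \<Rightarrow> complex"
  assumes G: "Cinf_on UNIV G" and per: "periodic_box G" and x: "x \<in> torus_box"
  shows "((\<lambda>k. fourier_coeff G k * fchar k x) has_sum G x) UNIV"
proof -
  let ?b = "fourier_coeff G"
  let ?S = "\<lambda>x. \<Sum>\<^sub>\<infinity>k. ?b k * fchar k x"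
  note sb = fourier_coeff_summable[OF G per]
  have sum: "(\<lambda>k. ?b k * fchar k x) summable_on UNIV" for x
    by (rule abs_summable_summable) (simp add: norm_mult sb)
  have cS: "continuous_on UNIV ?S"
  proof -
    have "uniform_limit UNIV (\<lambda>X x. \<Sum>k\<in>X. ?b k * fchar k x) ?S (finite_subsets_at_top UNIV)"
      using sb by (intro Weierstrass_m_test_general[where M = "\<lambda>k. cmod (?b k)"]) (auto simp: norm_mult)
    then show ?thesis
      by (rule uniform_limit_theorem[rotated]) (auto intro!: always_eventually continuous_intros)
  qed
  have cG: "continuous_on UNIV G" by (rule Cinf_on_continuous[OF G])
  have "G x - ?S x = 0"
  proof (rule zero_if_fourier_coeff_zero[where H = "\<lambda>x. G x - ?S x"])
    show "continuous_on UNIV (\<lambda>x. G x - ?S x)" by (intro continuous_intros cG cS)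
    show "periodic_box (\<lambda>x. G x - ?S x)" using per by (simp add: periodic_box_def fchar_periodic)
    fix k
    have "((\<lambda>j. integral torus_box (\<lambda>x. ?b j * fchar j x * fchar k x)) has_sum
        integral torus_box (\<lambda>x. \<Sum>\<^sub>\<infinity>j. ?b j * fchar j x * fchar k x)) UNIV"
      using sb by (intro has_sum_integral_dominated(1)[where M = "\<lambda>k. cmod (?b k)"])
        (auto simp: norm_mult intro!: continuous_intros)
    moreover have "(\<Sum>\<^sub>\<infinity>j. ?b j * fchar j x * fchar k x) = ?S x * fchar k x" for x
      using sum by (intro infsum_cmult_left) auto
    moreover have "integral torus_box (\<lambda>x. ?b j * fchar j x * fchar k x) =
        (if j = - k then (2 * of_real pi) ^ CARD('m) * ?b (- k) else 0)" for j
    proof -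
      have eq: "?b j * fchar j x * fchar k x = ?b j * fchar (j + k) x" for x
        by (simp add: fchar_add_left)
      show ?thesis unfolding eq
        by (simp add: Henstock_Kurzweil_Integration.integral_mult_right integral_fchar flip: eq_neg_iff_add_eq_0)
    qed
    ultimately have "((\<lambda>j. if j = - k then (2 * of_real pi) ^ CARD('m) * ?b (- k) else 0) has_sum
        integral torus_box (\<lambda>x. ?S x * fchar k x)) UNIV" by simp
    moreover have "((\<lambda>j. if j = - k then (2 * of_real pi) ^ CARD('m) * ?b (- k) else 0) has_sum
        (2 * of_real pi) ^ CARD('m) * ?b (- k)) UNIV"
      by (rule has_sum_finite_neutralI[of "{- k}"]) auto
    ultimately have "integral torus_box (\<lambda>x. ?S x * fchar k x) = (2 * of_real pi) ^ CARD('m) * ?b (- k)"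
      by (rule has_sum_unique)
    also have "\<dots> = integral torus_box (\<lambda>x. G x * fchar k x)"
      by (simp add: fourier_coeff_def)
    finally show "integral torus_box (\<lambda>x. (G x - ?S x) * fchar k x) = 0"
      using continuous_on_subset[OF cS subset_UNIV] continuous_on_subset[OF cG subset_UNIV]
      by (simp add: left_diff_distrib Henstock_Kurzweil_Integration.integral_diff integrable_continuous_on_compact
          continuous_on_mult continuous_on_fchar)
  qed (rule x)
  then show ?thesis using has_sum_infsum[OF sum[of x]] by simp
qed

section \<open>The trapezoidal rule\<close>

lemma has_sum_finite_sum:
  fixes f :: "'i \<Rightarrow> 'k \<Rightarrow> 'b::topological_comm_monoid_add"
  assumes "finite A" "\<And>i. i \<in> A \<Longrightarrow> (f i has_sum s i) I"
  shows "((\<lambda>k. \<Sum>i\<in>A. f i k) has_sum (\<Sum>i\<in>A. s i)) I"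
  using assms by (induction A rule: finite_induct) (auto intro: has_sum_add)

lemma has_sum_trapezoid:
  assumes "a \<le> b" and "\<And>t. a \<le> t \<Longrightarrow> t \<le> b \<Longrightarrow> ((\<lambda>k. u k t) has_sum g t) I"
  shows "((\<lambda>k. trapezoid a b q (u k)) has_sum trapezoid a b q g) I"
proof -
  have "a \<le> a + real k * ((b - a) / real q) \<and> a + real k * ((b - a) / real q) \<le> b"
    if "k \<in> {1..q - 1}" for k
  proof -
    have "real k * (b - a) \<le> real q * (b - a)"
      using that assms(1) by (intro mult_right_mono) auto
    then show ?thesis using that assms(1) by (auto simp: field_simps)
  qed
  then show ?thesis
    unfolding trapezoid_def Let_def using assms
    by (intro has_sum_add has_sum_cmult_right has_sum_finite_sum) auto
qed

lemma has_sum_trapezoid_var: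
  assumes "\<And>x. x \<in> torus_box \<Longrightarrow> ((\<lambda>k. u k x) has_sum g x) I" and "x \<in> torus_box"
  shows "((\<lambda>k. trapezoid_var n r (u k) x) has_sum trapezoid_var n r g x) I"
  unfolding trapezoid_var_def
  using assms by (intro has_sum_trapezoid) (auto simp: torus_box_def mem_box_cart)

lemma trapezoid_fold_insert:
  fixes n :: "nat^'m"
  assumes "r \<notin> A"
  shows "Finite_Set.fold (trapezoid_var n) g (insert r A) =
    trapezoid_var n r (Finite_Set.fold (trapezoid_var n) g A)"
proof -
  interpret comp_fun_commute "trapezoid_var n" by (rule comp_fun_commute_trapezoid_var)
  show ?thesis using assms by (intro fold_insert) auto
qed

text \<open>All nodes, and the final evaluation point 0, lie in \<open>torus_box\<close>, so
  convergence there is enough. For finite index sets this doubles as additivity of the rule.\<close>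

lemma has_sum_trapezoid_box:
  fixes u :: "'k \<Rightarrow> real^'m \<Rightarrow> complex"
  assumes "\<And>x. x \<in> torus_box \<Longrightarrow> ((\<lambda>k. u k x) has_sum g x) I"
  shows "((\<lambda>k. trapezoid_box n (u k)) has_sum trapezoid_box n g) I"
proof -
  have "((\<lambda>k. Finite_Set.fold (trapezoid_var n) (u k) A x) has_sum
      Finite_Set.fold (trapezoid_var n) g A x) I"
    if "finite A" "x \<in> torus_box" for A x
    using that
  proof (induction A arbitrary: x rule: finite_induct)
    case (insert r A)
    then show ?case
      unfolding trapezoid_fold_insert[OF insert.hyps(2)] by (intro has_sum_trapezoid_var)
  qed (simp add: assms)
  then show ?thesis
    unfolding trapezoid_box_def by (simp add: torus_box_def mem_box_cart)
qed

lemma trapezoid_exp: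
  assumes "1 \<le> q"
  shows "trapezoid (- pi) pi q (\<lambda>t. c * exp (\<i> * of_real (of_int j * t))) =
    c * (if int q dvd j then 2 * of_real pi * exp (- (\<i> * of_real (of_int j * pi))) else 0)"
proof -
  let ?e = "\<lambda>t. exp (\<i> * of_real (of_int j * t))"
  define h where "h = 2 * pi / real q"
  define \<omega> where "\<omega> = ?e h"
  have q: "real q * h = 2 * pi" using assms by (simp add: h_def)
  have per: "exp (of_int j * (2 * of_real pi * \<i>)) = 1"
    by (subst exp_eq_1) (auto intro!: exI[of _ j])
  have e_add: "?e (s + t) = ?e s * ?e t" for s t
    by (simp add: distrib_left exp_add)
  have e_2pi: "?e (2 * pi) = 1" using per by (simp add: mult_ac)
  have e_pi: "?e pi = ?e (- pi)"
    using e_add[of "- pi" "2 * pi"] e_2pi by simp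
  have pow: "?e (real k * h) = \<omega> ^ k" for k
    by (simp add: \<omega>_def mult_ac flip: exp_of_nat_mult)
  have "\<omega> ^ q = 1" using pow[of q] unfolding q e_2pi by (rule sym)
  \<comment> \<open>The mode takes equal values at both endpoints, so the two half weights merge
    into one full weight. What remains is a geometric sum over powers of \<open>\<omega>\<close>,
    whose \<open>q\<close>-th power is 1, times the value of the mode at
    \<open>- pi\<close>.\<close>
  have "trapezoid (- pi) pi q (\<lambda>t. c * ?e t) =
      of_real h * (c * ?e (- pi)) + of_real h * (\<Sum>k = 1..q - 1. c * ?e (- pi + real k * h))"
    unfolding trapezoid_def Let_def using e_pi by (simp add: h_def)
  also have "\<dots> = of_real h * c * ?e (- pi) * (1 + (\<Sum>k = 1..q - 1. \<omega> ^ k))"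
    unfolding e_add pow by (simp add: sum_distrib_left algebra_simps)
  also have "1 + (\<Sum>k = 1..q - 1. \<omega> ^ k) = (\<Sum>k<q. \<omega> ^ k)"
  proof -
    have "{..<q} = insert 0 {1..q - 1}" using assms by auto
    then show ?thesis by simp
  qed
  also have "of_real h * c * ?e (- pi) * (\<Sum>k<q. \<omega> ^ k) =
      c * (if int q dvd j then 2 * of_real pi * exp (- (\<i> * of_real (of_int j * pi))) else 0)"
  proof (cases "int q dvd j")
    case True
    then obtain i where i: "j = int q * i" by blast
    have "\<omega> = exp (of_int i * (2 * of_real pi * \<i>))"
      using assms by (simp add: \<omega>_def i h_def field_simps)
    also have "\<dots> = 1" by (subst exp_eq_1) (auto intro!: exI[of _ i])
    finally have "(\<Sum>k<q. \<omega> ^ k) = of_nat q" by simp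
    moreover have "of_real h * of_nat q = (2 * of_real pi :: complex)"
      using assms by (simp add: h_def)
    ultimately show ?thesis using True by (simp add: mult_ac)
  next
    case False
    have "\<omega> \<noteq> 1"
    proof
      assume "\<omega> = 1"
      then obtain i :: int where "of_int j * h = of_int (2 * i) * pi"
        unfolding \<omega>_def exp_eq_1 by auto
      then have "real_of_int j = of_int i * real q"
        using assms by (simp add: h_def field_simps)
      then have "j = i * int q" by (metis of_int_eq_iff of_int_mult of_int_of_nat_eq)
      then show False using False by simp
    qed
    then have "(\<Sum>k<q. \<omega> ^ k) = 0" using \<open>\<omega> ^ q = 1\<close> by (simp add: geometric_sum)
    then show ?thesis using False by simp
  qed
  finally show ?thesis .
qed

text \<open>The rule starts at \<open>- pi\<close>, so the aliased modes enter with the sign \<open>(- 1) ^ k $ r\<close>.\<close>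

definition alias_factor :: "nat^'m \<Rightarrow> int^'m \<Rightarrow> complex"
  where "alias_factor n k =
    (\<Prod>r\<in>UNIV. if int (n $ r) dvd k $ r then exp (- (\<i> * of_real (of_int (k $ r) * pi))) else 0)"

lemma trapezoid_box_fchar:
  fixes n :: "nat^'m"
  assumes n: "\<And>r. 1 \<le> n $ r"
  shows "trapezoid_box n (\<lambda>x. c * fchar k x) = (2 * of_real pi) ^ CARD('m) * c * alias_factor n k"
proof -
  let ?\<theta> = "\<lambda>r. if int (n $ r) dvd k $ r then 2 * of_real pi * exp (- (\<i> * of_real (of_int (k $ r) * pi))) else 0"
  \<comment> \<open>Invariant: each variable already treated has contributed a constant, and the
    exponential retains only the others.\<close>
  have "Finite_Set.fold (trapezoid_var n) (\<lambda>x. c * fchar k x) A =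
      (\<lambda>x. c * (\<Prod>r\<in>A. ?\<theta> r) * exp (\<i> * of_real (\<Sum>s\<in>UNIV - A. of_int (k $ s) * x $ s)))"
    if "finite A" for A
    using that
  proof (induction A rule: finite_induct)
    case empty
    show ?case by (simp add: fchar_def freq_dot_def)
  next
    case (insert r A)
    show ?case
    proof
      fix x :: "real^'m"
      let ?E = "exp (\<i> * of_real (\<Sum>s\<in>UNIV - insert r A. of_int (k $ s) * x $ s))"
      have eq: "exp (\<i> * of_real (\<Sum>s\<in>UNIV - A. of_int (k $ s) * (\<chi> s. if s = r then t else x $ s) $ s)) =
          ?E * exp (\<i> * of_real (of_int (k $ r) * t))" for t
      proof -
        have "UNIV - A = insert r (UNIV - insert r A)" using insert.hyps by auto
        moreover have "(\<Sum>s\<in>UNIV - insert r A. of_int (k $ s) * (\<chi> s. if s = r then t else x $ s) $ s) =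
            (\<Sum>s\<in>UNIV - insert r A. of_int (k $ s) * x $ s)"
          by (intro sum.cong) auto
        ultimately have "(\<Sum>s\<in>UNIV - A. of_int (k $ s) * (\<chi> s. if s = r then t else x $ s) $ s) =
            (\<Sum>s\<in>UNIV - insert r A. of_int (k $ s) * x $ s) + of_int (k $ r) * t" by simp
        then show ?thesis by (simp only: of_real_add distrib_left exp_add)
      qed
      have "Finite_Set.fold (trapezoid_var n) (\<lambda>x. c * fchar k x) (insert r A) x =
          trapezoid (- pi) pi (n $ r) (\<lambda>t. (c * (\<Prod>r\<in>A. ?\<theta> r) * ?E) * exp (\<i> * of_real (of_int (k $ r) * t)))"
        unfolding trapezoid_fold_insert[OF insert.hyps(2)] insert.IH trapezoid_var_def eq
        by (simp only: mult.assoc)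
      also have "\<dots> = c * (\<Prod>r\<in>insert r A. ?\<theta> r) * ?E"
        unfolding trapezoid_exp[OF n] using insert.hyps by simp
      finally show "Finite_Set.fold (trapezoid_var n) (\<lambda>x. c * fchar k x) (insert r A) x =
          c * (\<Prod>r\<in>insert r A. ?\<theta> r) * ?E" .
    qed
  qed
  from this[of UNIV] have "trapezoid_box n (\<lambda>x. c * fchar k x) = c * (\<Prod>r\<in>UNIV. ?\<theta> r)"
    by (simp add: trapezoid_box_def)
  also have "(\<Prod>r\<in>UNIV. ?\<theta> r) = (\<Prod>r\<in>UNIV. (2 * of_real pi) *
      (if int (n $ r) dvd k $ r then exp (- (\<i> * of_real (of_int (k $ r) * pi))) else 0))"
    by (intro prod.cong) auto
  also have "\<dots> = (2 * of_real pi) ^ CARD('m) * alias_factor n k"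
    by (simp add: prod.distrib alias_factor_def)
  finally show ?thesis by simp
qed

lemma alias_factor_0 [simp]: "alias_factor n 0 = 1"
  by (simp add: alias_factor_def)

lemma norm_alias_factor: "cmod (alias_factor n k) \<le> (if \<forall>r. int (n $ r) dvd k $ r then 1 else 0)"
proof (cases "\<forall>r. int (n $ r) dvd k $ r")
  case True
  then show ?thesis by (simp add: alias_factor_def flip: prod_norm)
next
  case False
  then have "alias_factor n k = 0" unfolding alias_factor_def by (intro prod_zero) auto
  then show ?thesis by simp
qed

lemma eq_0_if_dvd_abs_less: "int d dvd j \<Longrightarrow> \<bar>j\<bar> < int d \<Longrightarrow> j = 0"
  using dvd_imp_le_int[of j "int d"] by force

section \<open>Error of a single piece\<close>

lemma integral_extend_by_0:
  fixes f :: "'a::euclidean_space \<Rightarrow> 'b::banach"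
  assumes "S \<subseteq> T"
  shows "integral T (\<lambda>x. if x \<in> S then f x else 0) = integral S f"
    and "(\<lambda>x. if x \<in> S then f x else 0) integrable_on T \<longleftrightarrow> f integrable_on S"
  by (simp_all add: integral_def integrable_on_def has_integral_restrict[OF assms])

section \<open>Coefficients of the indicator and counting of aliases\<close>

lemma char_coeff_integral:
  fixes K :: "(real^'m) set"
  assumes "K \<subseteq> torus_box"
  shows "char_coeff K l = integral K (fchar (- l)) / (2 * of_real pi) ^ CARD('m)"
proof -
  have "(\<lambda>x. indicator K x * exp (- \<i> * of_real (freq_dot l x))) = (\<lambda>x. if x \<in> K then fchar (- l) x else 0)"
    by (auto simp: indicator_def fchar_def freq_dot_minus_left)
  then show ?thesis
    using assms by (simp add: char_coeff_def integral_extend_by_0(1))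
qed

lemma norm_char_coeff_le:
  fixes K :: "(real^'m) set"
  assumes "compact K" "K \<subseteq> torus_box"
  shows "cmod (char_coeff K l) \<le> 1"
proof -
  have "fchar (- l) integrable_on K"
    using assms by (intro integrable_continuous_on_compact continuous_on_fchar)
  then have "(\<lambda>x. if x \<in> K then fchar (- l) x else 0) integrable_on torus_box"
    using assms(2) by (simp add: integral_extend_by_0(2))
  then have "cmod (integral torus_box (\<lambda>x. if x \<in> K then fchar (- l) x else 0)) \<le>
      1 * measure lborel (torus_box :: (real^'m) set)"
    unfolding torus_box_def by (intro has_integral_bound[OF _ integrable_integral]) auto
  then have "cmod (integral K (fchar (- l))) \<le> (2 * pi) ^ CARD('m)"
    using assms(2) by (simp add: integral_extend_by_0(1) content_torus_box)
  then show ?thesis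
    using assms(2) by (simp add: char_coeff_integral norm_divide norm_power norm_mult)
qed

abbreviation freq_box :: "nat^'m \<Rightarrow> (int^'m) set"
  where "freq_box F \<equiv> {l. \<forall>r. \<bar>l $ r\<bar> \<le> int (F $ r)}"

text \<open>This is the source of the 2^m: an alias is determined by its sign pattern. In each
  coordinate two aliases are congruent modulo \<open>n $ r\<close>; if they have the same sign, they
  differ by at most \<open>F $ r < n $ r\<close> and so coincide.\<close>

lemma card_aliases_le:
  fixes F n :: "nat^'m"
  assumes "\<And>r. F $ r < n $ r"
  shows "card {l \<in> freq_box F. \<forall>r. int (n $ r) dvd (l + k) $ r} \<le> card (UNIV :: ('m \<Rightarrow> bool) set)"
proof (rule card_inj_on_le)
  show "inj_on (\<lambda>l r. 0 \<le> l $ r) {l \<in> freq_box F. \<forall>r. int (n $ r) dvd (l + k) $ r}"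
  proof (rule inj_onI)
    fix l l' assume l: "l \<in> {l \<in> freq_box F. \<forall>r. int (n $ r) dvd (l + k) $ r}"
      and l': "l' \<in> {l \<in> freq_box F. \<forall>r. int (n $ r) dvd (l + k) $ r}"
      and eq: "(\<lambda>r. 0 \<le> l $ r) = (\<lambda>r. 0 \<le> l' $ r)"
    have "l $ r = l' $ r" for r
    proof -
      have "int (n $ r) dvd (l + k) $ r - (l' + k) $ r" using l l' by (intro dvd_diff) auto
      then have "int (n $ r) dvd l $ r - l' $ r" by simp
      moreover have "\<bar>l $ r\<bar> \<le> int (F $ r)" "\<bar>l' $ r\<bar> \<le> int (F $ r)" using l l' by auto
      then have "\<bar>l $ r - l' $ r\<bar> < int (n $ r)"
        using fun_cong[OF eq, of r] assms[of r] by linarith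
      ultimately have "l $ r - l' $ r = 0" by (rule eq_0_if_dvd_abs_less)
      then show ?thesis by simp
    qed
    then show "l = l'" by (simp add: vec_eq_iff)
  qed
qed auto

text \<open>Up to normalization, the contribution of the \<open>k\<close>-th mode of the smooth factor to the error.\<close>

definition alias_defect :: "(real^'m) set \<Rightarrow> nat^'m \<Rightarrow> nat^'m \<Rightarrow> int^'m \<Rightarrow> complex"
  where "alias_defect K F n k =
    char_coeff K (- k) - (\<Sum>l\<in>freq_box F. char_coeff K l * alias_factor n (l + k))"

lemma norm_alias_defect_le:
  fixes K :: "(real^'m) set"
  assumes "compact K" "K \<subseteq> torus_box" "\<And>r. F $ r < n $ r"
  shows "cmod (alias_defect K F n k) \<le> 1 + card (UNIV :: ('m \<Rightarrow> bool) set)"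
proof -
  let ?S = "{l \<in> freq_box F. \<forall>r. int (n $ r) dvd (l + k) $ r}"
  have "cmod (char_coeff K l * alias_factor n (l + k)) \<le> (if \<forall>r. int (n $ r) dvd (l + k) $ r then 1 else 0)" for l
    unfolding norm_mult
    using mult_mono[OF norm_char_coeff_le[OF assms(1,2), of l] norm_alias_factor[of n "l + k"]] by simp
  then have "cmod (\<Sum>l\<in>freq_box F. char_coeff K l * alias_factor n (l + k)) \<le>
      (\<Sum>l\<in>freq_box F. if \<forall>r. int (n $ r) dvd (l + k) $ r then 1 else 0)"
    by (intro sum_norm_le) auto
  also have "\<dots> = card ?S"
    using finite_freq_box[of F] by (simp add: sum.If_cases Int_def)
  also have "\<dots> \<le> card (UNIV :: ('m \<Rightarrow> bool) set)"
    using card_aliases_le[OF assms(3)] by simp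
  finally show ?thesis
    unfolding alias_defect_def
    using norm_triangle_ineq4[of "char_coeff K (- k)" "\<Sum>l\<in>freq_box F. char_coeff K l * alias_factor n (l + k)"]
      norm_char_coeff_le[OF assms(1,2), of "- k"] by linarith
qed

text \<open>The two assumptions do separate jobs: the first keeps \<open>- k\<close> within the
  truncation, the second leaves no room for any other alias.\<close>

lemma alias_defect_eq_0:
  assumes "\<And>r. \<bar>k $ r\<bar> \<le> int (F $ r)" "\<And>r. \<bar>k $ r\<bar> + int (F $ r) < int (n $ r)"
  shows "alias_defect K F n k = 0"
proof -
  have 0: "alias_factor n (l + k) = 0" if l: "l \<in> freq_box F" "l \<noteq> - k" for l
  proof -
    obtain r where r: "l $ r + k $ r \<noteq> 0"
      using l(2) by (auto simp: vec_eq_iff eq_neg_iff_add_eq_0)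
    have "\<bar>l $ r\<bar> \<le> int (F $ r)" using l(1) by simp
    then have "\<bar>l $ r + k $ r\<bar> < int (n $ r)" using assms(2)[of r] by linarith
    then have "\<not> int (n $ r) dvd (l + k) $ r" using r eq_0_if_dvd_abs_less by auto
    then show ?thesis using norm_alias_factor[of n "l + k"] by (auto split: if_splits)
  qed
  have "- k \<in> freq_box F" using assms(1) by simp
  then have "(\<Sum>l\<in>freq_box F. char_coeff K l * alias_factor n (l + k)) =
      (\<Sum>l\<in>{- k}. char_coeff K l * alias_factor n (l + k))"
    using 0 finite_freq_box[of F] by (intro sum.mono_neutral_right) auto
  then show ?thesis by (simp add: alias_defect_def)
qed

text \<open>Integral and rule are both applied termwise to the expansion of the smooth factor.
  Integrating mode \<open>k\<close> over \<open>K\<close> produces the coefficient of the indicator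
  at \<open>- k\<close>, so both contributions share the factor \<open>fourier_coeff G k\<close> and
  can be subtracted mode by mode.\<close>

lemma has_sum_piece_error:
  fixes G :: "real^'m \<Rightarrow> complex"
  assumes K: "compact K" "K \<subseteq> torus_box" and G: "Cinf_on UNIV G" "periodic_box G"
    and g: "\<And>x. x \<in> torus_box \<Longrightarrow> g x = G x" and n: "\<And>r. 1 \<le> n $ r"
  shows "((\<lambda>k. (2 * of_real pi) ^ CARD('m) * fourier_coeff G k * alias_defect K F n k) has_sum
    (integral K g - trapezoid_box n (\<lambda>x. char_trunc K F x * g x))) UNIV"
proof -
  let ?b = "fourier_coeff G" and ?\<pi> = "(2 * of_real pi) ^ CARD('m) :: complex"
  have trunc: "char_trunc K F x = (\<Sum>l\<in>freq_box F. char_coeff K l * fchar l x)" for x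
    by (simp add: char_trunc_def fchar_def)
  have "((\<lambda>k. char_trunc K F x * (?b k * fchar k x)) has_sum char_trunc K F x * g x) UNIV"
    if "x \<in> torus_box" for x
    using has_sum_cmult_right[OF fourier_expansion[OF G that]] g[OF that] by simp
  then have "((\<lambda>k. trapezoid_box n (\<lambda>x. char_trunc K F x * (?b k * fchar k x))) has_sum
      trapezoid_box n (\<lambda>x. char_trunc K F x * g x)) UNIV"
    by (rule has_sum_trapezoid_box)
  moreover have "trapezoid_box n (\<lambda>x. char_trunc K F x * (?b k * fchar k x)) =
      ?\<pi> * ?b k * (\<Sum>l\<in>freq_box F. char_coeff K l * alias_factor n (l + k))" for k
  proof -
    have "((\<lambda>l. trapezoid_box n (\<lambda>x. char_coeff K l * ?b k * fchar (l + k) x)) has_sum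
        trapezoid_box n (\<lambda>x. char_trunc K F x * (?b k * fchar k x))) (freq_box F)"
      by (rule has_sum_trapezoid_box, rule has_sum_finiteI)
        (simp_all add: finite_freq_box trunc fchar_add_left sum_distrib_left sum_distrib_right mult_ac)
    then have eq: "trapezoid_box n (\<lambda>x. char_trunc K F x * (?b k * fchar k x)) =
        (\<Sum>l\<in>freq_box F. trapezoid_box n (\<lambda>x. char_coeff K l * ?b k * fchar (l + k) x))"
      using has_sum_finite[OF finite_freq_box] by (rule has_sum_unique)
    show ?thesis
      unfolding eq trapezoid_box_fchar[OF n] by (simp add: sum_distrib_left mult_ac)
  qed
  ultimately have T: "((\<lambda>k. ?\<pi> * ?b k * (\<Sum>l\<in>freq_box F. char_coeff K l * alias_factor n (l + k))) has_sum
      trapezoid_box n (\<lambda>x. char_trunc K F x * g x)) UNIV" by simp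
  have "((\<lambda>k. integral K (\<lambda>x. ?b k * fchar k x)) has_sum
      integral K (\<lambda>x. \<Sum>\<^sub>\<infinity>k. ?b k * fchar k x)) UNIV"
    by (rule has_sum_integral_dominated(1)[OF K(1) _ _ fourier_coeff_summable[OF G]])
      (auto simp: norm_mult intro!: continuous_intros)
  moreover have "integral K (\<lambda>x. \<Sum>\<^sub>\<infinity>k. ?b k * fchar k x) = integral K g"
    using K(2) g by (intro Henstock_Kurzweil_Integration.integral_cong)
      (auto intro!: infsumI fourier_expansion[OF G, THEN has_sum_cong[THEN iffD1, rotated]])
  moreover have "integral K (\<lambda>x. ?b k * fchar k x) = ?\<pi> * ?b k * char_coeff K (- k)" for k
    by (simp add: char_coeff_integral[OF K(2)] Henstock_Kurzweil_Integration.integral_mult_right)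
  ultimately have "((\<lambda>k. ?\<pi> * ?b k * char_coeff K (- k)) has_sum integral K g) UNIV" by (simp only:)
  from has_sum_add[OF this has_sum_uminusI[OF T]]
  show ?thesis by (simp add: alias_defect_def right_diff_distrib)
qed

lemma piece_error_le:
  fixes K :: "(real^'m) set"
  assumes K: "compact K" "K \<subseteq> torus_box" and g: "Cinf_per g" and a: "0 < a" "a < 1"
  obtains C where "0 \<le> C"
    "\<And>F n. (\<And>r. 1 \<le> F $ r) \<Longrightarrow> (\<And>r. real (F $ r) \<le> a * real (n $ r)) \<Longrightarrow>
      cmod (integral K g - trapezoid_box n (\<lambda>x. char_trunc K F x * g x)) \<le> C / real (vmin F) ^ p"
proof -
  obtain G where G: "Cinf_on UNIV G" "periodic_box G" and gG: "\<And>x. x \<in> torus_box \<Longrightarrow> g x = G x"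
    using g unfolding Cinf_per_def periodic_box_def by metis
  obtain B where B: "0 \<le> B" "\<And>k s. cmod (fourier_coeff G k) \<le>
      B * (\<Prod>r\<in>UNIV. inverse (freq_weight (k $ r) ^ 2)) * inverse (freq_weight (k $ s) ^ p)"
    using fourier_coeff_decay[OF G] by blast
  \<comment> \<open>A contributing mode violates one of two conditions in some coordinate
    \<open>r\<close>: either it exceeds \<open>F $ r\<close>, or it is at least
    \<open>n $ r - F $ r\<close>, hence at least \<open>(1 / a - 1) * F $ r\<close>. The minimum
    covers both cases.\<close>
  define \<delta> where "\<delta> = min 1 (1 / a - 1)"
  have \<delta>: "0 < \<delta>" "\<delta> \<le> 1" "\<delta> \<le> 1 / a - 1" using a by (auto simp: \<delta>_def)
  define N where "N = 1 + real (card (UNIV :: ('m \<Rightarrow> bool) set))"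
  have N: "0 \<le> N" by (simp add: N_def)
  let ?W = "\<lambda>k :: int^'m. \<Prod>r\<in>UNIV. inverse (freq_weight (k $ r) ^ 2)"
  have W: "0 \<le> ?W k" for k
    by (intro prod_nonneg ballI) (simp add: freq_weight_pos less_imp_le)
  define A where "A = (2 * pi) ^ CARD('m) * N * B / \<delta> ^ p"
  have A: "0 \<le> A" using N B(1) \<delta> by (simp add: A_def)
  have err: "cmod (integral K g - trapezoid_box n (\<lambda>x. char_trunc K F x * g x)) \<le>
      A * infsum ?W UNIV / real (vmin F) ^ p"
    if F: "\<And>r. 1 \<le> F $ r" and Fn: "\<And>r. real (F $ r) \<le> a * real (n $ r)" for F n
  proof -
    have lt: "F $ r < n $ r" for r
    proof -
      have "0 < real (n $ r)" using F[of r] Fn[of r] a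
        by (metis of_nat_0_less_iff gr0I mult_zero_right not_one_le_zero of_nat_0 of_nat_le_0_iff)
      then have "a * real (n $ r) < real (n $ r)" using a by simp
      then show ?thesis using Fn[of r] by linarith
    qed
    then have n: "1 \<le> n $ r" for r using gr_implies_not0 by (metis less_one linorder_not_le)
    have vmin: "vmin F \<le> F $ r" for r unfolding vmin_def by (intro Min_le) auto
    have "vmin F \<in> range (\<lambda>r. F $ r)" unfolding vmin_def by (intro Min_in) auto
    then have v1: "1 \<le> vmin F" using F by auto
    have le: "cmod ((2 * of_real pi) ^ CARD('m) * fourier_coeff G k * alias_defect K F n k) \<le>
        A / real (vmin F) ^ p * ?W k" for k
    proof (cases "\<forall>r. \<bar>k $ r\<bar> \<le> int (F $ r) \<and> \<bar>k $ r\<bar> + int (F $ r) < int (n $ r)")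
      case True
      then show ?thesis using A W[of k] by (simp add: alias_defect_eq_0)
    next
      case False
      then obtain r where r: "\<not> (\<bar>k $ r\<bar> \<le> int (F $ r) \<and> \<bar>k $ r\<bar> + int (F $ r) < int (n $ r))" by blast
      have "\<delta> * real (F $ r) \<le> \<bar>real_of_int (k $ r)\<bar>"
      proof (cases "\<bar>k $ r\<bar> \<le> int (F $ r)")
        case True
        then have "int (n $ r) - int (F $ r) \<le> \<bar>k $ r\<bar>" using r by linarith
        then have "real (n $ r) - real (F $ r) \<le> \<bar>real_of_int (k $ r)\<bar>" by linarith
        moreover have "real (F $ r) / a \<le> real (n $ r)"
          using Fn[of r] a by (simp add: pos_divide_le_eq mult.commute)
        moreover have "\<delta> * real (F $ r) \<le> (1 / a - 1) * real (F $ r)"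
          using \<delta> by (intro mult_right_mono) auto
        ultimately show ?thesis by (simp add: left_diff_distrib)
      next
        case False
        have "\<delta> * real (F $ r) \<le> 1 * real (F $ r)" using \<delta> by (intro mult_right_mono) auto
        then show ?thesis using False by linarith
      qed
      moreover have "\<delta> * real (vmin F) \<le> \<delta> * real (F $ r)"
        using \<delta> vmin[of r] by (intro mult_left_mono) auto
      ultimately have w: "\<delta> * real (vmin F) \<le> freq_weight (k $ r)" by (simp add: freq_weight_def)
      have pos: "0 < \<delta> * real (vmin F)" using \<delta> v1 by simp
      \<comment> \<open>The reserved decay factor is spent in the coordinate \<open>r\<close> where
        the condition fails. This coordinate depends on \<open>k\<close>, but the resulting bound
        does not, and the other factor is left for summation.\<close>
      have "inverse (freq_weight (k $ r) ^ p) \<le> inverse ((\<delta> * real (vmin F)) ^ p)"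
        using w pos by (intro le_imp_inverse_le power_mono zero_less_power) auto
      then have "cmod (fourier_coeff G k) \<le> B * ?W k * inverse ((\<delta> * real (vmin F)) ^ p)"
        using order_trans[OF B(2)[of k r] mult_left_mono] B(1) W[of k] by simp
      moreover have "cmod (alias_defect K F n k) \<le> N"
        using norm_alias_defect_le[OF K lt] by (simp add: N_def)
      ultimately have "cmod (fourier_coeff G k) * cmod (alias_defect K F n k) \<le>
          B * ?W k * inverse ((\<delta> * real (vmin F)) ^ p) * N"
        using B(1) W[of k] pos by (intro mult_mono) auto
      then have "(2 * pi) ^ CARD('m) * (cmod (fourier_coeff G k) * cmod (alias_defect K F n k)) \<le>
          (2 * pi) ^ CARD('m) * (B * ?W k * inverse ((\<delta> * real (vmin F)) ^ p) * N)"
        by (intro mult_left_mono) auto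
      also have "\<dots> = A / real (vmin F) ^ p * ?W k"
        by (simp add: A_def power_mult_distrib divide_inverse mult_ac)
      finally show ?thesis by (simp add: norm_mult norm_power mult.assoc)
    qed
    have "cmod (integral K g - trapezoid_box n (\<lambda>x. char_trunc K F x * g x)) \<le>
        A / real (vmin F) ^ p * infsum ?W UNIV"
      by (rule norm_infsum_le[OF has_sum_piece_error[OF K G gG n]
            has_sum_cmult_right[OF has_sum_infsum[OF summable_on_prod_freq_weight]] le])
    then show ?thesis by simp
  qed
  have "0 \<le> A * infsum ?W UNIV" using A W by (intro mult_nonneg_nonneg infsum_nonneg)
  then show ?thesis using err by (rule that)
qed

section \<open>The total error\<close>

text \<open>Since \<open>\<Omega> j\<close> is open and disjoint from \<open>\<Omega> j'\<close>, it
  also misses the closure of the latter. Two pieces can thus meet only on the frontier of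
  \<open>\<Omega> j\<close>, which is null.\<close>

lemma has_integral_pieces:
  fixes f :: "real^'m \<Rightarrow> complex"
  assumes fin: "finite I"
    and K: "\<And>j. j \<in> I \<Longrightarrow> K j = closure (\<Omega> j)"
    and op: "\<And>j. j \<in> I \<Longrightarrow> open (\<Omega> j)"
    and disj: "disjoint_family_on \<Omega> I"
    and bd: "\<And>j. j \<in> I \<Longrightarrow> lipschitz_boundary (\<Omega> j) \<or> piecewise_smooth_boundary (\<Omega> j)"
    and f: "\<And>j. j \<in> I \<Longrightarrow> (f has_integral i j) (K j)"
  shows "(f has_integral (\<Sum>j\<in>I. i j)) (\<Union>j\<in>I. K j)"
proof (rule has_integral_UN[OF fin])
  show "pairwise (\<lambda>j j'. negligible (K j \<inter> K j')) I"
  proof (rule pairwiseI)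
    fix j j' assume j: "j \<in> I" "j' \<in> I" "j \<noteq> j'"
    have "negligible (frontier (\<Omega> j))"
      using bd[OF j(1)] op[OF j(1)] negligible_frontier_lipschitz negligible_frontier_piecewise_smooth by blast
    moreover have "\<Omega> j \<inter> closure (\<Omega> j') = {}"
      using disj j op by (subst open_Int_closure_eq_empty) (auto simp: disjoint_family_on_def)
    then have "K j \<inter> K j' \<subseteq> frontier (\<Omega> j)"
      using K j op by (auto simp: frontier_def interior_open)
    ultimately show "negligible (K j \<inter> K j')" by (rule negligible_subset)
  qed
qed (rule f)

lemma total_error_le:
  fixes D :: "(real^'m) set"
  assumes "D \<subseteq> torus_box"
    and D: "D = (\<Union>j\<in>{1..P}. K j)"
    and K: "\<And>j. j \<in> {1..P} \<Longrightarrow> K j = closure (\<Omega> j)"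
    and op: "\<And>j. j \<in> {1..P} \<Longrightarrow> open (\<Omega> j)"
    and disj: "disjoint_family_on \<Omega> {1..P}"
    and bd: "\<And>j. j \<in> {1..P} \<Longrightarrow> lipschitz_boundary (\<Omega> j) \<or> piecewise_smooth_boundary (\<Omega> j)"
    and ft: "\<And>j. j \<in> {1..P} \<Longrightarrow> Cinf_per (ft j)"
    and ext: "\<And>j x. j \<in> {1..P} \<Longrightarrow> x \<in> K j \<Longrightarrow> ft j x = f x"
    and a: "0 < a" "a < 1"
  obtains C where "0 \<le> C"
    "\<And>F n. (\<And>r. 1 \<le> F $ r) \<Longrightarrow> (\<And>r. real (F $ r) \<le> a * real (n $ r)) \<Longrightarrow>
      total_error D P K f ft n F \<le> C / real (vmin F) ^ p"
proof -
  have sub: "K j \<subseteq> torus_box" if "j \<in> {1..P}" for j using assms(1) D that by blast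
  have cp: "compact (K j)" if "j \<in> {1..P}" for j
    using sub[OF that] K[OF that] compact_imp_bounded[OF compact_torus_box] bounded_subset
    by (auto simp: compact_eq_bounded_closed)
  define bound where "bound j C \<longleftrightarrow> 0 \<le> C \<and>
      (\<forall>F n. (\<forall>r. 1 \<le> F $ r) \<longrightarrow> (\<forall>r. real (F $ r) \<le> a * real (n $ r)) \<longrightarrow>
        cmod (integral (K j) (ft j) - trapezoid_box n (\<lambda>x. char_trunc (K j) F x * ft j x)) \<le> C / real (vmin F) ^ p)"
    for j C
  have "\<exists>C. bound j C" if "j \<in> {1..P}" for j
    unfolding bound_def
    by (rule piece_error_le[OF cp[OF that] sub[OF that] ft[OF that] a, where p = p]) blast
  then obtain C where C: "\<And>j. j \<in> {1..P} \<Longrightarrow> bound j (C j)"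
    using bchoice[of "{1..P}" bound] by blast
  \<comment> \<open>Values of \<open>f\<close> on overlaps cause no conflict, since \<open>f\<close>
    agrees with \<open>ft j\<close> on all of the closed piece. Integrability is taken from the
    continuous extension of \<open>ft j\<close>.\<close>
  have "(f has_integral integral (K j) (ft j)) (K j)" if j: "j \<in> {1..P}" for j
  proof -
    obtain G where G: "Cinf_on UNIV G" "\<And>x. x \<in> torus_box \<Longrightarrow> G x = ft j x"
      using ft[OF j] unfolding Cinf_per_def by blast
    have "continuous_on (K j) G"
      using Cinf_on_continuous[OF G(1)] continuous_on_subset by blast
    moreover have "continuous_on (K j) (ft j) = continuous_on (K j) G"
      using G(2) sub[OF j] by (intro continuous_on_cong) auto
    ultimately have "ft j integrable_on K j"
      by (intro integrable_continuous_on_compact cp[OF j]) simp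
    then have "(ft j has_integral integral (K j) (ft j)) (K j)" by (rule integrable_integral)
    then show ?thesis using ext[OF j] by (rule has_integral_eq[rotated])
  qed
  then have "(f has_integral (\<Sum>j\<in>{1..P}. integral (K j) (ft j))) D"
    unfolding D by (intro has_integral_pieces[OF _ K op disj bd]) auto
  then have I: "integral D f = (\<Sum>j\<in>{1..P}. integral (K j) (ft j))" by (rule integral_unique)
  have err: "total_error D P K f ft n F \<le> (\<Sum>j\<in>{1..P}. C j) / real (vmin F) ^ p"
    if F: "\<And>r. 1 \<le> F $ r" and Fn: "\<And>r. real (F $ r) \<le> a * real (n $ r)" for F n
  proof -
    let ?g = "\<lambda>j x. char_trunc (K j) F x * ft j x"
    \<comment> \<open>Additivity of the rule, read off from its compatibility with sums over a
      finite index set.\<close>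
    have "((\<lambda>j. trapezoid_box n (?g j)) has_sum trapezoid_box n (\<lambda>x. \<Sum>j = 1..P. ?g j x)) {1..P}"
      by (rule has_sum_trapezoid_box) simp
    then have "trapezoid_box n (\<lambda>x. \<Sum>j = 1..P. ?g j x) = (\<Sum>j\<in>{1..P}. trapezoid_box n (?g j))"
      using has_sum_finite[OF finite_atLeastAtMost] by (rule has_sum_unique)
    then have "total_error D P K f ft n F =
        cmod (\<Sum>j\<in>{1..P}. integral (K j) (ft j) - trapezoid_box n (?g j))"
      by (simp add: total_error_def I sum_subtractf)
    also have "\<dots> \<le> (\<Sum>j\<in>{1..P}. C j / real (vmin F) ^ p)"
      using C F Fn unfolding bound_def by (intro sum_norm_le) blast
    finally show ?thesis by (simp add: sum_divide_distrib)
  qed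
  have "0 \<le> (\<Sum>j\<in>{1..P}. C j)" using C unfolding bound_def by (intro sum_nonneg) blast
  then show ?thesis using err by (rule that)
qed

theorem theorem1:
  fixes D :: "(real^'m) set"
    and \<Omega> K :: "nat \<Rightarrow> (real^'m) set"
    and P :: nat
    and f :: "real^'m \<Rightarrow> complex"
    and ft :: "nat \<Rightarrow> real^'m \<Rightarrow> complex"
    and a :: real
  assumes "compact D" and "D \<subseteq> interior torus_box"
    and "1 \<le> P"
    and "D = (\<Union>j\<in>{1..P}. K j)"
    and "\<And>j. j \<in> {1..P} \<Longrightarrow> K j = closure (\<Omega> j)"
    and "\<And>j. j \<in> {1..P} \<Longrightarrow> open (\<Omega> j)"
    and "\<And>j. j \<in> {1..P} \<Longrightarrow> \<Omega> j \<subseteq> interior D"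
    and "disjoint_family_on \<Omega> {1..P}"
    and "\<And>j. j \<in> {1..P} \<Longrightarrow> lipschitz_boundary (\<Omega> j) \<or> piecewise_smooth_boundary (\<Omega> j)"
    and "\<And>j. j \<in> {1..P} \<Longrightarrow> Cinf_compact (K j) f"
    and "\<And>j. j \<in> {1..P} \<Longrightarrow> Cinf_per (ft j)"
    and "\<And>j x. j \<in> {1..P} \<Longrightarrow> x \<in> K j \<Longrightarrow> ft j x = f x"
    and "0 < a" and "a < 1"
  shows "(\<forall>p::nat. 1 \<le> p \<longrightarrow> (\<exists>C::real. \<forall>F n :: nat^'m.
            (\<forall>r. 1 \<le> F $ r \<and> 1 \<le> n $ r) \<and> (\<forall>r. real (F $ r) \<le> a * real (n $ r)) \<and> 2 \<le> vmax F \<longrightarrow>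
            total_error D P K f ft n F \<le> C * (ln (real (vmax F)) / real (vmin F) ^ p)))
       \<and> (\<forall>M::real. 0 < M \<longrightarrow> (\<forall>p::nat. 1 \<le> p \<longrightarrow> (\<exists>C::real. \<forall>F n :: nat^'m.
            (\<forall>r. 1 \<le> F $ r \<and> 1 \<le> n $ r) \<and> (\<forall>r. real (F $ r) \<le> a * real (n $ r)) \<and>
            (\<forall>r. 2 \<le> real (n $ r) / real (F $ r) \<and> real (n $ r) / real (F $ r) \<le> M) \<longrightarrow>
            total_error D P K f ft n F \<le> C * (ln (real (vmax n)) / real (vmin n) ^ p))))"
proof (intro conjI allI impI)
  have "D \<subseteq> torus_box" using assms(2) interior_subset by blast
  have bound: "\<exists>C\<ge>0. \<forall>F n. (\<forall>r. 1 \<le> F $ r) \<longrightarrow> (\<forall>r. real (F $ r) \<le> a * real (n $ r)) \<longrightarrow>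
      total_error D P K f ft n F \<le> C / real (vmin F) ^ p" for p
  proof (rule total_error_le[where D = D and P = P and K = K and \<Omega> = \<Omega> and ft = ft and f = f and a = a and p = p])
    fix C
    assume "0 \<le> C" and "\<And>F n. (\<And>r. 1 \<le> F $ r) \<Longrightarrow> (\<And>r. real (F $ r) \<le> a * real (n $ r)) \<Longrightarrow>
        total_error D P K f ft n F \<le> C / real (vmin F) ^ p"
    then show ?thesis by blast
  qed (fact assms \<open>D \<subseteq> torus_box\<close>)+
  have vmaxI: "v $ r \<le> vmax v" for v :: "nat^'m" and r unfolding vmax_def by (intro Max_ge) auto
  {
    fix p :: nat
    obtain C where C: "0 \<le> C" "\<And>F n. \<forall>r. 1 \<le> F $ r \<Longrightarrow> \<forall>r. real (F $ r) \<le> a * real (n $ r) \<Longrightarrow>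
        total_error D P K f ft n F \<le> C / real (vmin F) ^ p"
      using bound[of p] by blast
    show "\<exists>C::real. \<forall>F n :: nat^'m.
        (\<forall>r. 1 \<le> F $ r \<and> 1 \<le> n $ r) \<and> (\<forall>r. real (F $ r) \<le> a * real (n $ r)) \<and> 2 \<le> vmax F \<longrightarrow>
        total_error D P K f ft n F \<le> C * (ln (real (vmax F)) / real (vmin F) ^ p)"
    \<comment> \<open>As \<open>2 \<le> vmax F\<close>, the quotient
      \<open>ln (vmax F) / ln 2\<close> is at least 1 and may be multiplied onto the bound.\<close>
    proof (intro exI[of _ "C / ln 2"] allI impI, elim conjE)
      fix F n :: "nat^'m"
      assume F: "\<forall>r. 1 \<le> F $ r \<and> 1 \<le> n $ r" "\<forall>r. real (F $ r) \<le> a * real (n $ r)" "2 \<le> vmax F"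
      have "ln 2 \<le> ln (real (vmax F))" using F(3) by (subst ln_le_cancel_iff) auto
      then have "C / real (vmin F) ^ p * 1 \<le> C / real (vmin F) ^ p * (ln (real (vmax F)) / ln 2)"
        using C(1) by (intro mult_left_mono) auto
      moreover have "total_error D P K f ft n F \<le> C / real (vmin F) ^ p" using C(2) F by blast
      ultimately show "total_error D P K f ft n F \<le> C / ln 2 * (ln (real (vmax F)) / real (vmin F) ^ p)"
        by (simp add: mult_ac)
    qed
  }
  {
    fix M :: real and p :: nat
    assume M: "0 < M"
    obtain C where C: "0 \<le> C" "\<And>F n. \<forall>r. 1 \<le> F $ r \<Longrightarrow> \<forall>r. real (F $ r) \<le> a * real (n $ r) \<Longrightarrow>
        total_error D P K f ft n F \<le> C / real (vmin F) ^ p"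
      using bound[of p] by blast
    show "\<exists>C::real. \<forall>F n :: nat^'m.
        (\<forall>r. 1 \<le> F $ r \<and> 1 \<le> n $ r) \<and> (\<forall>r. real (F $ r) \<le> a * real (n $ r)) \<and>
        (\<forall>r. 2 \<le> real (n $ r) / real (F $ r) \<and> real (n $ r) / real (F $ r) \<le> M) \<longrightarrow>
        total_error D P K f ft n F \<le> C * (ln (real (vmax n)) / real (vmin n) ^ p)"
    \<comment> \<open>The factor \<open>M ^ p\<close> pays for replacing \<open>vmin F\<close> by
      \<open>vmin n\<close>; division by \<open>ln 2\<close> absorbs the logarithm as before, where
      \<open>2 \<le> vmax n\<close> now follows from the lower bound on the ratios.\<close>
    proof (intro exI[of _ "C * M ^ p / ln 2"] allI impI, elim conjE)
      fix F n :: "nat^'m"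
      assume F: "\<forall>r. 1 \<le> F $ r \<and> 1 \<le> n $ r" "\<forall>r. real (F $ r) \<le> a * real (n $ r)"
        and nF: "\<forall>r. 2 \<le> real (n $ r) / real (F $ r) \<and> real (n $ r) / real (F $ r) \<le> M"
      have F1: "1 \<le> real (F $ r)" for r using F(1) by simp
      have n2: "2 * real (F $ r) \<le> real (n $ r)" and nM: "real (n $ r) \<le> M * real (F $ r)" for r
        using nF[rule_format, of r] F1[of r] by (simp_all add: field_simps)
      \<comment> \<open>Here \<open>undefined\<close> merely names some coordinate.\<close>
      have "2 \<le> real (n $ undefined)" using n2[of undefined] F1[of undefined] by linarith
      then have "2 \<le> vmax n" using vmaxI[of n undefined] by linarith
      then have ln: "ln 2 \<le> ln (real (vmax n))" by (subst ln_le_cancel_iff) auto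
      have "vmin F \<in> range (\<lambda>r. F $ r)" "vmin n \<in> range (\<lambda>r. n $ r)"
        unfolding vmin_def by (intro Min_in; simp)+
      then obtain r r' where r: "vmin F = F $ r" and r': "vmin n = n $ r'" by blast
      \<comment> \<open>The two minima may be attained at different coordinates; comparing at the
        one where \<open>F\<close> is minimal gives the inequality in the required
        direction.\<close>
      have "vmin n \<le> n $ r" unfolding vmin_def by (intro Min_le) auto
      then have le: "real (vmin n) \<le> M * real (vmin F)" using nM[of r] unfolding r by linarith
      have pos: "0 < real (vmin n)" "0 < real (vmin F)" using r r' F(1) by (simp_all add: Suc_le_eq)
      have "real (vmin n) ^ p \<le> M ^ p * real (vmin F) ^ p"
        using power_mono[OF le, of p] by (simp add: power_mult_distrib)
      then have "C * real (vmin n) ^ p \<le> C * (M ^ p * real (vmin F) ^ p)"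
        using C(1) by (rule mult_left_mono)
      then have "C / real (vmin F) ^ p \<le> C * M ^ p / real (vmin n) ^ p"
        using pos by (simp add: field_simps)
      also have "\<dots> * 1 \<le> C * M ^ p / real (vmin n) ^ p * (ln (real (vmax n)) / ln 2)"
        using C(1) M ln by (intro mult_left_mono) auto
      finally have "C / real (vmin F) ^ p \<le> C * M ^ p / ln 2 * (ln (real (vmax n)) / real (vmin n) ^ p)"
        by (simp add: mult_ac)
      moreover have "total_error D P K f ft n F \<le> C / real (vmin F) ^ p" using C(2) F by blast
      ultimately show "total_error D P K f ft n F \<le> C * M ^ p / ln 2 * (ln (real (vmax n)) / real (vmin n) ^ p)"
        by linarith
    qed
  }
qed

end
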